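(* Let $\mathcal{H}_W$ be an algebra satisfying properties ( * ) and ( ** ), and let $D=\sum_{i=1}^na_ic_i\in\mathcal{H}_W$. Let $(\pi,X)$ be an irreducible $\mathcal{H}_W$-supermodule with central character $\chi_\pi:Z(\mathcal H_W)_0\to\mathbb{C}$. Let $$H_D(X)=\ker\pi(D)/(\ker\pi(D)\cap\mathrm{im}\,\pi(D)).$$ Then $H_D(X)$ has a natural $\mathrm{Seg}(W)$-module structure (induced from the action on $X$). Let $(\sigma,U)$ be an irreducible $\mathrm{Seg}(W)$-module with central character $\chi_\sigma:Z(\mathrm{Seg}(W))_0\to\mathbb{C}$ such that $\mathrm{Hom}_{\mathrm{Seg}(W)}(U,H_D(X))\neq0$. Define $\chi^\sigma:Z(\mathcal{H}_W)_0\to\mathbb{C}$ by $\chi^\sigma(z)=\chi_\sigma(\zeta(z))$. Then $\chi_\pi=\chi^\sigma$.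
   Context: All algebras are associative and unital over $\mathbb{C}$. For a superalgebra $\mathcal A=\mathcal A_0\oplus\mathcal A_1$, $Z(\mathcal A)$ is its (ordinary) center and $Z(\mathcal A)_0=Z(\mathcal A)\cap\mathcal A_0$. A supermodule is irreducible if it has no proper nonzero supersubmodule (graded submodule). The central character of an irreducible (super)module is the map sending $z\in Z(\mathcal A)_0$ to the scalar by which $z$ acts. Let $W$ be a (finite) real reflection group, $V$ a representation of $W$ with a fixed $W$-invariant inner product, and $\{a_1,\dots,a_n\}$ an orthogonal basis of $V$. Property ( * ): $\mathcal H_W=\mathcal H_W(V)$ is an algebra generated by symbols $f_w$ ($w\in W$), $c_i$ and $a_i$ ($i=1,\dots,n$) such that $w\mapsto f_w$ extends to an injective algebra map $\mathbb{C}[W]\to\mathcal H_W$ (one writes $w$ for $f_w$), the elements $a_1^{k_1}\cdots a_n^{k_n}c_1^{\epsilon_1}\cdots c_n^{\epsilon_n}w$ ($k_i\in\mathbb{Z}_{\ge0}$, $\epsilon_i\in\{0,1\}$, $w\in W$) form a basis of $\mathcal H_W$, and, with $\mathrm{Seg}(W)$ denoting the subalgebra generated by all $w\in W$ and $c_1,\dots,c_n$, the following relations hold: $wa_iw^{-1}=w(a_i)$; $[a_i,a_j]c_ic_j\in\mathrm{Seg}(W)$ for $i\ne j$; $c_ja_i=a_ic_j$ for $i\neq j$; $c_ia_i=-a_ic_i$; $c_ic_j=-c_jc_i$ for $i\ne j$ and $c_i^2=-1$; $wc_i=w(c_i)w$. Here $w(a_i)$ is the action of $w$ on $V$, and $w(c_i)$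 is the action of $w$ on the span of the $c_i$ identified with $V$ via $a_i\mapsto c_i$. $\mathcal H_W$ is a superalgebra with $\deg(c_i)=1$, $\deg(a_i)=\deg(w)=0$. Homogeneous $h_1,h_2$ supercommute if $h_1h_2=(-1)^{\deg(h_1)\deg(h_2)}h_2h_1$ (extended bilinearly to all elements). Property ( ** ): for every $h\in\mathcal H_W$ which supercommutes with all elements of $\mathrm{Seg}(W)$, one has $D^2h-hD^2=0$. The map $\zeta:Z(\mathcal{H}_W)_0\to Z(\mathrm{Seg}(W))_0$: let $d(h)=Dh-(-1)^{\deg(h)}hD$ for homogeneous $h\in\mathcal H_W$ (extended linearly). For each $z\in Z(\mathcal{H}_W)_0$ there is a unique $\zeta(z)\in Z(\mathrm{Seg}(W))_0$ with $z-\zeta(z)\in\mathrm{im}\,d$. *)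

theory Defs
  imports
    "HOL-Analysis.Euclidean_Space"
    "HOL-Library.FuncSet"
    "HOL-Algebra.AbelCoset"
    "HOL-Algebra.Module"
    "HOL-Algebra.Bij"
    "HOL-Algebra.Generated_Groups"
begin

section \<open>Finite real reflection groups and their orthogonal representations\<close>

definition reflection_along :: "'e::real_inner \<Rightarrow> 'e \<Rightarrow> 'e" where
  "reflection_along \<alpha> x = x - (2 * inner x \<alpha> / inner \<alpha> \<alpha>) *\<^sub>R \<alpha>"

definition finite_reflection_group :: "('e::euclidean_space \<Rightarrow> 'e) set \<Rightarrow> bool" where
  "finite_reflection_group W \<longleftrightarrow>
     finite W \<and> (\<exists>R. 0 \<notin> R \<and> W = generate (BijGroup UNIV) (reflection_along ` R))"

text \<open>The fixed invariant inner product on the representation space is the one of the type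
  class; the group law on \<open>W\<close> is composition of functions.\<close>

definition orthogonal_rep :: "('e \<Rightarrow> 'e) set \<Rightarrow> (('e \<Rightarrow> 'e) \<Rightarrow> 'v::real_inner \<Rightarrow> 'v) \<Rightarrow> bool" where
  "orthogonal_rep W \<rho> \<longleftrightarrow>
     (\<forall>w\<in>W. linear (\<rho> w)) \<and> \<rho> id = id \<and>
     (\<forall>u\<in>W. \<forall>w\<in>W. \<rho> (u \<circ> w) = \<rho> u \<circ> \<rho> w) \<and>
     (\<forall>w\<in>W. \<forall>x y. inner (\<rho> w x) (\<rho> w y) = inner x y)"

definition orthogonal_basis :: "nat \<Rightarrow> (nat \<Rightarrow> 'v::real_inner) \<Rightarrow> bool" where
  "orthogonal_basis n v \<longleftrightarrow>
     inj_on v {1..n} \<and> independent (v ` {1..n}) \<and> span (v ` {1..n}) = UNIV \<and>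
     (\<forall>i\<in>{1..n}. \<forall>j\<in>{1..n}. i \<noteq> j \<longrightarrow> inner (v i) (v j) = 0)"

section \<open>Complex superalgebras\<close>

definition is_subalgebra :: "(complex \<Rightarrow> 'h::ring_1 \<Rightarrow> 'h) \<Rightarrow> 'h set \<Rightarrow> bool" where
  "is_subalgebra scl S \<longleftrightarrow>
     module.subspace scl S \<and> 1 \<in> S \<and> (\<forall>x\<in>S. \<forall>y\<in>S. x * y \<in> S)"

text \<open>\<open>G 0\<close> and \<open>G 1\<close> are the even and the odd part; other values of \<open>G\<close> play no role.\<close>

locale superalgebra = vector_space scl
  for scl :: "complex \<Rightarrow> 'h::ring_1 \<Rightarrow> 'h" +
  fixes G :: "nat \<Rightarrow> 'h set"
  assumes scale_mult_left: "scl t x * y = scl t (x * y)"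
    and scale_mult_right: "x * scl t y = scl t (x * y)"
    and subspace_even: "module.subspace scl (G 0)"
    and subspace_odd: "module.subspace scl (G 1)"
    and even_Int_odd: "G 0 \<inter> G 1 = {0}"
    and even_plus_odd: "\<exists>x\<in>G 0. \<exists>y\<in>G 1. h = x + y"
    and one_even: "1 \<in> G 0"
    and mult_graded:
      "\<lbrakk>i < 2; j < 2; x \<in> G i; y \<in> G j\<rbrakk> \<Longrightarrow> x * y \<in> G ((i + j) mod 2)"

text \<open>The component of degree \<open>i \<in> {0, 1}\<close>.\<close>

definition component :: "(nat \<Rightarrow> 'h::ring_1 set) \<Rightarrow> nat \<Rightarrow> 'h \<Rightarrow> 'h" where
  "component G i h = (THE x. x \<in> G i \<and> h - x \<in> G (1 - i))"

text \<open>Bilinear extension of \<open>h k = (-1)\<^bsup>deg h deg k\<^esup> k h\<close>.\<close>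

definition supercommute :: "(nat \<Rightarrow> 'h::ring_1 set) \<Rightarrow> 'h \<Rightarrow> 'h \<Rightarrow> bool" where
  "supercommute G h k \<longleftrightarrow>
     (\<Sum>i<2. \<Sum>j<2. component G i h * component G j k
                  - (-1) ^ (i * j) * (component G j k * component G i h)) = 0"

text \<open>\<open>Z(S)\<^sub>0\<close> for a graded subalgebra \<open>S\<close>; the center is the ordinary one.\<close>

definition even_center :: "(nat \<Rightarrow> 'h::ring_1 set) \<Rightarrow> 'h set \<Rightarrow> 'h set" where
  "even_center G S = {z \<in> S \<inter> G 0. \<forall>s\<in>S. z * s = s * z}"

section \<open>The algebras \<open>\<H>\<^sub>W\<close>\<close>

definition Seg ::
  "(complex \<Rightarrow> 'h::ring_1 \<Rightarrow> 'h) \<Rightarrow> ('e \<Rightarrow> 'e) set \<Rightarrow> nat \<Rightarrow>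
   (('e \<Rightarrow> 'e) \<Rightarrow> 'h) \<Rightarrow> (nat \<Rightarrow> 'h) \<Rightarrow> 'h set" where
  "Seg scl W n f c = is_subalgebra scl hull (f ` W \<union> c ` {1..n})"

text \<open>The linear map \<open>V \<rightarrow> \<H>\<^sub>W\<close> with \<open>v\<^sub>i \<mapsto> b\<^sub>i\<close>, for a basis \<open>v\<^sub>1, \<dots>, v\<^sub>n\<close> of \<open>V\<close>.\<close>

definition basis_map ::
  "(complex \<Rightarrow> 'h::ring_1 \<Rightarrow> 'h) \<Rightarrow> nat \<Rightarrow> (nat \<Rightarrow> 'v::real_inner) \<Rightarrow> (nat \<Rightarrow> 'h) \<Rightarrow> 'v \<Rightarrow> 'h" where
  "basis_map scl n v b x =
     (\<Sum>j=1..n. scl (complex_of_real (representation (v ` {1..n}) x (v j))) (b j))"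

text \<open>\<open>a\<^sub>1\<^bsup>k\<^sub>1\<^esup> \<cdots> a\<^sub>n\<^bsup>k\<^sub>n\<^esup> c\<^sub>1\<^bsup>\<epsilon>\<^sub>1\<^esup> \<cdots> c\<^sub>n\<^bsup>\<epsilon>\<^sub>n\<^esup> w\<close>, the factors being taken in this order.\<close>

definition pbw_monomial ::
  "nat \<Rightarrow> (('e \<Rightarrow> 'e) \<Rightarrow> 'h::ring_1) \<Rightarrow> (nat \<Rightarrow> 'h) \<Rightarrow> (nat \<Rightarrow> 'h) \<Rightarrow>
   (nat \<Rightarrow> nat) \<times> (nat \<Rightarrow> nat) \<times> ('e \<Rightarrow> 'e) \<Rightarrow> 'h" where
  "pbw_monomial n f c a = (\<lambda>(k, \<epsilon>, w).
     prod_list (map (\<lambda>i. a i ^ k i) [1..<Suc n]) *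
     prod_list (map (\<lambda>i. c i ^ \<epsilon> i) [1..<Suc n]) * f w)"

definition pbw_index ::
  "nat \<Rightarrow> ('e \<Rightarrow> 'e) set \<Rightarrow> ((nat \<Rightarrow> nat) \<times> (nat \<Rightarrow> nat) \<times> ('e \<Rightarrow> 'e)) set" where
  "pbw_index n W = ({1..n} \<rightarrow>\<^sub>E UNIV) \<times> ({1..n} \<rightarrow>\<^sub>E {0, 1}) \<times> W"

text \<open>The orthogonal basis of \<open>V\<close> is \<open>v\<close>, and \<open>a\<close> denotes its copy in the algebra. Elements of
  \<open>\<complex>[W]\<close> are the functions vanishing off \<open>W\<close>; their linear map to the algebra determined by \<open>f\<close>
  is an algebra map iff \<open>f\<close> is unital and multiplicative on \<open>W\<close>.\<close>

locale hecke_clifford = superalgebra scl G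
  for scl :: "complex \<Rightarrow> 'h::ring_1 \<Rightarrow> 'h" and G :: "nat \<Rightarrow> 'h set" +
  fixes W :: "('e::euclidean_space \<Rightarrow> 'e) set"
    and \<rho> :: "('e \<Rightarrow> 'e) \<Rightarrow> 'v::real_inner \<Rightarrow> 'v"
    and n :: nat
    and v :: "nat \<Rightarrow> 'v"
    and f :: "('e \<Rightarrow> 'e) \<Rightarrow> 'h"
    and c a :: "nat \<Rightarrow> 'h"
  assumes reflection_group: "finite_reflection_group W"
    and orthogonal_rep: "orthogonal_rep W \<rho>"
    and orthogonal_basis: "orthogonal_basis n v"
    and generated: "is_subalgebra scl hull (f ` W \<union> c ` {1..n} \<union> a ` {1..n}) = UNIV"
    and f_id: "f id = 1"
    and f_comp: "\<lbrakk>u \<in> W; w \<in> W\<rbrakk> \<Longrightarrow> f (u \<circ> w) = f u * f w"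
    and f_inj: "inj_on (\<lambda>\<phi>. \<Sum>w\<in>W. scl (\<phi> w) (f w)) {\<phi>. \<forall>w. w \<notin> W \<longrightarrow> \<phi> w = 0}"
    and pbw_inj: "inj_on (pbw_monomial n f c a) (pbw_index n W)"
    and pbw_independent:
      "\<not> module.dependent scl (pbw_monomial n f c a ` pbw_index n W)"
    and pbw_span: "module.span scl (pbw_monomial n f c a ` pbw_index n W) = UNIV"
    and w_a: "\<lbrakk>w \<in> W; i \<in> {1..n}\<rbrakk> \<Longrightarrow>
      f w * a i * f (inv_into UNIV w) = basis_map scl n v a (\<rho> w (v i))"
    and a_a: "\<lbrakk>i \<in> {1..n}; j \<in> {1..n}; i \<noteq> j\<rbrakk> \<Longrightarrow>
      (a i * a j - a j * a i) * c i * c j \<in> Seg scl W n f c"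
    and c_a: "\<lbrakk>i \<in> {1..n}; j \<in> {1..n}; i \<noteq> j\<rbrakk> \<Longrightarrow> c j * a i = a i * c j"
    and c_a_same: "i \<in> {1..n} \<Longrightarrow> c i * a i = - (a i * c i)"
    and c_c: "\<lbrakk>i \<in> {1..n}; j \<in> {1..n}; i \<noteq> j\<rbrakk> \<Longrightarrow> c i * c j = - (c j * c i)"
    and c_square: "i \<in> {1..n} \<Longrightarrow> c i ^ 2 = -1"
    and w_c: "\<lbrakk>w \<in> W; i \<in> {1..n}\<rbrakk> \<Longrightarrow>
      f w * c i = basis_map scl n v c (\<rho> w (v i)) * f w"
    and c_odd: "i \<in> {1..n} \<Longrightarrow> c i \<in> G 1"
    and a_even: "i \<in> {1..n} \<Longrightarrow> a i \<in> G 0"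
    and f_even: "w \<in> W \<Longrightarrow> f w \<in> G 0"

definition dirac :: "nat \<Rightarrow> (nat \<Rightarrow> 'h::ring_1) \<Rightarrow> (nat \<Rightarrow> 'h) \<Rightarrow> 'h" where
  "dirac n a c = (\<Sum>i=1..n. a i * c i)"

definition dirac_square_central :: "(nat \<Rightarrow> 'h::ring_1 set) \<Rightarrow> 'h set \<Rightarrow> 'h \<Rightarrow> bool" where
  "dirac_square_central G S D \<longleftrightarrow>
     (\<forall>h. (\<forall>s\<in>S. supercommute G h s) \<longrightarrow> D ^ 2 * h - h * D ^ 2 = 0)"

text \<open>Linear extension of \<open>h \<mapsto> D h - (-1)\<^bsup>deg h\<^esup> h D\<close>.\<close>

definition dirac_d :: "(nat \<Rightarrow> 'h::ring_1 set) \<Rightarrow> 'h \<Rightarrow> 'h \<Rightarrow> 'h" where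
  "dirac_d G D h = (\<Sum>i<2. D * component G i h - (-1) ^ i * (component G i h * D))"

definition zeta :: "(nat \<Rightarrow> 'h::ring_1 set) \<Rightarrow> 'h set \<Rightarrow> 'h \<Rightarrow> 'h \<Rightarrow> 'h" where
  "zeta G S D z = (THE s. s \<in> even_center G S \<and> z - s \<in> range (dirac_d G D))"

section \<open>Modules over subalgebras\<close>

text \<open>The multiplicative fields \<open>mult\<close> and \<open>one\<close> of the record type \<open>module\<close> are unused. The
  library's locale of the same name requires a commutative base ring, hence the following
  predicates. A unital algebra contains the scalars \<open>scl t 1\<close>, so
  these modules are complex vector spaces, and submodules and homomorphisms are automatically
  complex linear.\<close>

definition left_module :: "'h::ring_1 set \<Rightarrow> ('h, 'x) module \<Rightarrow> bool" where
  "left_module A M \<longleftrightarrow> abelian_group M \<and>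
     (\<forall>r\<in>A. \<forall>x\<in>carrier M. r \<odot>\<^bsub>M\<^esub> x \<in> carrier M) \<and>
     (\<forall>r\<in>A. \<forall>s\<in>A. \<forall>x\<in>carrier M. (r + s) \<odot>\<^bsub>M\<^esub> x = r \<odot>\<^bsub>M\<^esub> x \<oplus>\<^bsub>M\<^esub> s \<odot>\<^bsub>M\<^esub> x) \<and>
     (\<forall>r\<in>A. \<forall>x\<in>carrier M. \<forall>y\<in>carrier M. r \<odot>\<^bsub>M\<^esub> (x \<oplus>\<^bsub>M\<^esub> y) = r \<odot>\<^bsub>M\<^esub> x \<oplus>\<^bsub>M\<^esub> r \<odot>\<^bsub>M\<^esub> y) \<and>
     (\<forall>r\<in>A. \<forall>s\<in>A. \<forall>x\<in>carrier M. (r * s) \<odot>\<^bsub>M\<^esub> x = r \<odot>\<^bsub>M\<^esub> (s \<odot>\<^bsub>M\<^esub> x)) \<and>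
     (\<forall>x\<in>carrier M. 1 \<odot>\<^bsub>M\<^esub> x = x)"

definition left_submodule :: "'h::ring_1 set \<Rightarrow> ('h, 'x) module \<Rightarrow> 'x set \<Rightarrow> bool" where
  "left_submodule A M N \<longleftrightarrow>
     additive_subgroup N M \<and> (\<forall>r\<in>A. \<forall>x\<in>N. r \<odot>\<^bsub>M\<^esub> x \<in> N)"

definition irreducible_module :: "'h::ring_1 set \<Rightarrow> ('h, 'x) module \<Rightarrow> bool" where
  "irreducible_module A M \<longleftrightarrow>
     left_module A M \<and> carrier M \<noteq> {\<zero>\<^bsub>M\<^esub>} \<and>
     (\<forall>N. left_submodule A M N \<longrightarrow> N = {\<zero>\<^bsub>M\<^esub>} \<or> N = carrier M)"

definition supermodule ::
  "(nat \<Rightarrow> 'h::ring_1 set) \<Rightarrow> ('h, 'x) module \<Rightarrow> (nat \<Rightarrow> 'x set) \<Rightarrow> bool" where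
  "supermodule G M P \<longleftrightarrow>
     left_module UNIV M \<and> additive_subgroup (P 0) M \<and> additive_subgroup (P 1) M \<and>
     P 0 \<inter> P 1 = {\<zero>\<^bsub>M\<^esub>} \<and> P 0 <+>\<^bsub>M\<^esub> P 1 = carrier M \<and>
     (\<forall>i<2. \<forall>j<2. \<forall>h\<in>G i. \<forall>x\<in>P j. h \<odot>\<^bsub>M\<^esub> x \<in> P ((i + j) mod 2))"

definition irreducible_supermodule ::
  "(nat \<Rightarrow> 'h::ring_1 set) \<Rightarrow> ('h, 'x) module \<Rightarrow> (nat \<Rightarrow> 'x set) \<Rightarrow> bool" where
  "irreducible_supermodule G M P \<longleftrightarrow>
     supermodule G M P \<and> carrier M \<noteq> {\<zero>\<^bsub>M\<^esub>} \<and>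
     (\<forall>N. left_submodule UNIV M N \<and> N = (N \<inter> P 0) <+>\<^bsub>M\<^esub> (N \<inter> P 1)
        \<longrightarrow> N = {\<zero>\<^bsub>M\<^esub>} \<or> N = carrier M)"

text \<open>Only the values of \<open>\<chi>\<close> on \<open>Z\<close> are meaningful.\<close>

definition central_character ::
  "(complex \<Rightarrow> 'h::ring_1 \<Rightarrow> 'h) \<Rightarrow> 'h set \<Rightarrow> ('h, 'x) module \<Rightarrow> ('h \<Rightarrow> complex) \<Rightarrow> bool" where
  "central_character scl Z M \<chi> \<longleftrightarrow>
     (\<forall>z\<in>Z. \<forall>x\<in>carrier M. z \<odot>\<^bsub>M\<^esub> x = scl (\<chi> z) 1 \<odot>\<^bsub>M\<^esub> x)"

definition module_homs ::
  "'h::ring_1 set \<Rightarrow> ('h, 'x) module \<Rightarrow> ('h, 'y) module \<Rightarrow> ('x \<Rightarrow> 'y) set" where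
  "module_homs A M N = {\<phi> \<in> carrier M \<rightarrow> carrier N.
     (\<forall>x\<in>carrier M. \<forall>y\<in>carrier M. \<phi> (x \<oplus>\<^bsub>M\<^esub> y) = \<phi> x \<oplus>\<^bsub>N\<^esub> \<phi> y) \<and>
     (\<forall>r\<in>A. \<forall>x\<in>carrier M. \<phi> (r \<odot>\<^bsub>M\<^esub> x) = r \<odot>\<^bsub>N\<^esub> \<phi> x)}"

section \<open>Dirac cohomology\<close>

definition dirac_ker :: "('h, 'x) module \<Rightarrow> 'h \<Rightarrow> 'x set" where
  "dirac_ker X D = {x \<in> carrier X. D \<odot>\<^bsub>X\<^esub> x = \<zero>\<^bsub>X\<^esub>}"

definition dirac_im :: "('h, 'x) module \<Rightarrow> 'h \<Rightarrow> 'x set" where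
  "dirac_im X D = (\<lambda>x. D \<odot>\<^bsub>X\<^esub> x) ` carrier X"

definition dirac_class :: "('h, 'x) module \<Rightarrow> 'h \<Rightarrow> 'x \<Rightarrow> 'x set" where
  "dirac_class X D x = (dirac_ker X D \<inter> dirac_im X D) +>\<^bsub>X\<^esub> x"

text \<open>The quotient of \<open>ker D\<close> by \<open>ker D \<inter> im D\<close>, realised as the set of cosets with the
  operations induced from \<open>X\<close>. The action is meaningful only for those elements of the algebra
  that preserve \<open>ker D\<close> and \<open>ker D \<inter> im D\<close>.\<close>

definition dirac_cohomology :: "('h, 'x) module \<Rightarrow> 'h \<Rightarrow> ('h, 'x set) module" where
  "dirac_cohomology X D =
     \<lparr>carrier = dirac_class X D ` dirac_ker X D,
      mult = undefined, one = undefined,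
      zero = dirac_ker X D \<inter> dirac_im X D,
      add = set_add X,
      smult = (\<lambda>s C. \<Union>x\<in>C. dirac_class X D (s \<odot>\<^bsub>X\<^esub> x))\<rparr>"

end

theory Submission
  imports Defs
begin

text \<open>
  Everything rests on the existence and uniqueness of \<open>\<zeta>(z)\<close>. With respect to the filtration by
  degree in the \<open>a\<^sub>i\<close>, the symbol of \<open>d\<close> is the differential of a tensor product of \<open>n\<close> complexes,
  one for each variable: \<open>a\<^sub>i\<^bsup>k\<^esup>\<close> with \<open>k\<close> odd is mapped to \<open>-2 a\<^sub>i\<^bsup>k+1\<^esup> c\<^sub>i\<close> and even powers to
  \<open>0\<close>. An explicit contracting homotopy shows that its cohomology is \<open>Seg(W)\<close>, in degree \<open>0\<close>.
  Averaging over the finite group generated by the \<open>c\<^sub>i\<close> and \<open>W\<close> moves the primitives produced by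
  the homotopy into the supercommutant of \<open>Seg(W)\<close>, where \<open>d\<^sup>2 = 0\<close> by hypothesis. Descending in
  the filtration, any \<open>y\<close> in the supercommutant with \<open>d y \<in> Seg(W)\<close> is \<open>d x\<close> plus an element of
  \<open>Seg(W)\<close>, so \<open>d y = 0\<close>; for \<open>y = z\<close> this gives the existence of \<open>\<zeta>(z)\<close>, and the vanishing of
  \<open>d y\<close> gives the uniqueness. Finally \<open>z - \<zeta>(z) = D y - y' D\<close>, where \<open>y'\<close> is \<open>y\<close> with its odd
  part negated, maps \<open>ker D\<close> into \<open>im D\<close>, so \<open>z\<close> and \<open>\<zeta>(z)\<close> act on cohomology in the same way.
\<close>

section \<open>Superalgebras\<close>

context superalgebra
begin

declare One_nat_def [simp del]

abbreviation is_linear :: "('h \<Rightarrow> 'h) \<Rightarrow> bool" where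
  "is_linear \<equiv> Vector_Spaces.linear scl scl"

lemma mult_scale_one: "x * scl t 1 = scl t x"
  by (simp add: scale_mult_right)

lemma scale_half_double: "scl (1/2) (x + x) = x"
proof -
  have "scl (1/2) (x + x) = scl (1/2 + 1/2) x"
    by (simp only: scale_right_distrib scale_left_distrib)
  then show ?thesis by simp
qed

lemma is_linearI:
  assumes "\<And>x y. g (x + y) = g x + g y" and "\<And>t x. g (scl t x) = scl t (g x)"
  shows "is_linear g"
  using assms by (intro Vector_Spaces.linear.intro module_hom.intro module_hom_axioms.intro)
    (auto intro: vector_space_axioms module_axioms)

text \<open>Two decompositions of \<open>h\<close> differ by an element of \<open>G 0\<close>
  \<inter> \<open>G 1\<close>, so the description in \<open>component\<close> has a unique
  solution.\<close>

lemma component_eqI: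
  assumes "x \<in> G 0" "y \<in> G 1" "h = x + y"
  shows "component G 0 h = x" and "component G 1 h = y"
proof -
  have unique: "x' = x \<and> y' = y" if "x' \<in> G 0" "y' \<in> G 1" "x' + y' = h" for x' y'
  proof -
    have "x' - x \<in> G 0" "y - y' \<in> G 1"
      using that assms subspace_even subspace_odd by (auto intro: subspace_diff)
    moreover have "x' - x = y - y'"
      using that assms by (simp add: algebra_simps)
    ultimately have "x' - x \<in> G 0 \<inter> G 1" by simp
    then have "x' - x = 0" using even_Int_odd by blast
    then show ?thesis using \<open>x' - x = y - y'\<close> by simp
  qed
  show "component G 0 h = x"
    unfolding component_def
  proof (rule the_equality)
    fix x' assume "x' \<in> G 0 \<and> h - x' \<in> G (1 - 0)"
    then show "x' = x" using unique[of x' "h - x'"] by simp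
  qed (use assms in simp)
  show "component G 1 h = y"
    unfolding component_def
  proof (rule the_equality)
    fix y' assume "y' \<in> G 1 \<and> h - y' \<in> G (1 - 1)"
    then show "y' = y" using unique[of "h - y'" y'] by simp
  qed (use assms in simp)
qed

lemma component_in: "component G 0 h \<in> G 0" "component G 1 h \<in> G 1"
  and component_sum: "component G 0 h + component G 1 h = h"
proof -
  obtain x y where "x \<in> G 0" "y \<in> G 1" "h = x + y"
    using even_plus_odd by blast
  then show "component G 0 h \<in> G 0" "component G 1 h \<in> G 1" "component G 0 h + component G 1 h = h"
    using component_eqI by simp_all
qed

text \<open>The grading involution. It encodes the sign (-1)^deg(h) as a linear operation on all
  elements, so that graded identities need no splitting into homogeneous parts.\<close>

definition parity :: "'h \<Rightarrow> 'h" where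
  "parity h = component G 0 h - component G 1 h"

lemma parity_eqI: "x \<in> G 0 \<Longrightarrow> y \<in> G 1 \<Longrightarrow> parity (x + y) = x - y"
  unfolding parity_def using component_eqI[OF _ _ refl] by simp

lemma parity_add: "parity (x + y) = parity x + parity y"
proof -
  have "x + y = (component G 0 x + component G 0 y) + (component G 1 x + component G 1 y)"
    using component_sum[of x] component_sum[of y] by (metis add.assoc add.left_commute)
  moreover have "component G 0 x + component G 0 y \<in> G 0"
    "component G 1 x + component G 1 y \<in> G 1"
    using component_in subspace_even subspace_odd by (auto intro: subspace_add)
  ultimately show ?thesis
    using parity_eqI by (simp add: parity_def)
qed

lemma parity_scale: "parity (scl t x) = scl t (parity x)"
proof -
  have "scl t x = scl t (component G 0 x) + scl t (component G 1 x)"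
    using component_sum[of x] by (metis scale_right_distrib)
  moreover have "scl t (component G 0 x) \<in> G 0" "scl t (component G 1 x) \<in> G 1"
    using component_in subspace_even subspace_odd by (auto intro: subspace_scale)
  ultimately show ?thesis
    using parity_eqI by (simp add: parity_def scale_right_diff_distrib)
qed

lemma parity_even: "x \<in> G 0 \<Longrightarrow> parity x = x"
  using parity_eqI[of x 0] subspace_odd by (simp add: subspace_0)

lemma parity_odd: "x \<in> G 1 \<Longrightarrow> parity x = - x"
  using parity_eqI[of 0 x] subspace_even by (simp add: subspace_0)

lemma linear_parity: "is_linear parity"
  by (rule is_linearI) (simp_all add: parity_add parity_scale)

lemma parity_simps [simp]:
  "parity 0 = 0" "parity (- x) = - parity x" "parity (x - y) = parity x - parity y"
  "parity (sum g A) = (\<Sum>i\<in>A. parity (g i))"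
proof -
  interpret P: Vector_Spaces.linear scl scl parity by (rule linear_parity)
  show "parity 0 = 0" "parity (- x) = - parity x" "parity (x - y) = parity x - parity y"
    "parity (sum g A) = (\<Sum>i\<in>A. parity (g i))"
    by (rule P.zero P.neg P.diff P.sum)+
qed

lemma parity_parity [simp]: "parity (parity h) = h"
  using component_sum[of h]
  by (simp add: parity_def[of h] parity_even parity_odd component_in)

lemma parity_mult: "parity (x * y) = parity x * parity y"
proof -
  define x0 x1 y0 y1 where "x0 = component G 0 x" and "x1 = component G 1 x"
    and "y0 = component G 0 y" and "y1 = component G 1 y"
  have G: "x0 \<in> G 0" "x1 \<in> G 1" "y0 \<in> G 0" "y1 \<in> G 1"
    unfolding x0_def x1_def y0_def y1_def by (rule component_in)+
  have xy: "x = x0 + x1" "y = y0 + y1"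
    unfolding x0_def x1_def y0_def y1_def by (rule component_sum[symmetric])+
  have "x0 * y0 + x1 * y1 \<in> G 0" "x0 * y1 + x1 * y0 \<in> G 1"
    using G mult_graded[of 0 0] mult_graded[of 1 1] mult_graded[of 0 1] mult_graded[of 1 0]
      subspace_even subspace_odd by (auto intro!: subspace_add)
  from parity_eqI[OF this] have "parity (x * y) = x0 * y0 + x1 * y1 - (x0 * y1 + x1 * y0)"
    by (simp add: xy algebra_simps)
  also have "\<dots> = parity x * parity y"
    using G by (simp add: xy parity_eqI algebra_simps)
  finally show ?thesis .
qed

text \<open>The components are the projections onto the eigenspaces 1 and -1 of the
  involution.\<close>

lemma component_parity:
  "component G 0 h = scl (1/2) (h + parity h)" "component G 1 h = scl (1/2) (h - parity h)"
proof -
  have "h + parity h = component G 0 h + component G 0 h"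
    "h - parity h = component G 1 h + component G 1 h"
    unfolding parity_def by (subst (1) component_sum[of h, symmetric], simp)+
  then show "component G 0 h = scl (1/2) (h + parity h)" "component G 1 h = scl (1/2) (h - parity h)"
    by (simp_all add: scale_half_double)
qed

lemma even_iff_parity: "h \<in> G 0 \<longleftrightarrow> parity h = h"
  by (metis component_in(1) component_parity(1) parity_even scale_half_double)

section \<open>Supercommutation and the odd derivation in terms of the involution\<close>

text \<open>The sign is -1 only for two odd components, and \<open>parity h\<close> supplies it in
  the product with the odd part of \<open>k\<close>.\<close>

lemma supercommute_iff:
  "supercommute G h k \<longleftrightarrow>
     h * k = component G 0 k * h + component G 1 k * parity h"
proof -
  define h0 h1 k0 k1 where "h0 = component G 0 h" and "h1 = component G 1 h"
    and "k0 = component G 0 k" and "k1 = component G 1 k"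
  have hk: "h = h0 + h1" "k = k0 + k1" "parity h = h0 - h1"
    unfolding h0_def h1_def k0_def k1_def parity_def by (simp_all only: component_sum)
  have "supercommute G h k \<longleftrightarrow>
    h0 * k0 - k0 * h0 + (h0 * k1 - k1 * h0) + (h1 * k0 - k0 * h1 + (h1 * k1 + k1 * h1)) = 0"
    unfolding supercommute_def numeral_2_eq_2 h0_def h1_def k0_def k1_def
    by (simp add: One_nat_def)
  also have "\<dots> \<longleftrightarrow> (h0 + h1) * (k0 + k1) - (k0 * (h0 + h1) + k1 * (h0 - h1)) = 0"
    by (simp add: algebra_simps)
  finally show ?thesis
    by (simp add: hk(3) flip: hk(1,2) k0_def k1_def)
qed

text \<open>With the involution, \<open>dirac_d\<close> becomes a twisted commutator, also for
  inhomogeneous \<open>h\<close>.\<close>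

lemma dirac_d_eq: "dirac_d G D h = D * h - parity h * D"
proof -
  have "dirac_d G D h = D * component G 0 h - component G 0 h * D
     + (D * component G 1 h + component G 1 h * D)"
    unfolding dirac_d_def numeral_2_eq_2 by (simp add: One_nat_def)
  also have "\<dots> = D * (component G 0 h + component G 1 h) - parity h * D"
    by (simp add: parity_def algebra_simps)
  finally show ?thesis by (simp only: component_sum)
qed

text \<open>A set of elements that supercommute with a fixed \<open>h\<close> need not be closed under products
  unless their homogeneous components supercommute with \<open>h\<close> separately.\<close>

lemma supercommute_hull:
  assumes gens: "\<And>k. k \<in> B \<Longrightarrow>
      k \<in> G 0 \<and> h * k = k * h \<or> k \<in> G 1 \<and> h * k = k * parity h"
    and s: "s \<in> is_subalgebra scl hull B"
  shows "supercommute G h s"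
proof -
  define Q where "Q = {x + y | x y. x \<in> G 0 \<and> y \<in> G 1 \<and> h * x = x * h \<and> h * y = y * parity h}"
  have QI: "x + y \<in> Q"
    if "x \<in> G 0" "y \<in> G 1" "h * x = x * h" "h * y = y * parity h" for x y
    using that unfolding Q_def by blast
  have zero: "0 \<in> G 0" "0 \<in> G 1"
    using subspace_even subspace_odd by (auto intro: subspace_0)
  have "is_subalgebra scl Q"
    unfolding is_subalgebra_def
  proof (intro conjI ballI)
    show "subspace Q"
    proof (rule subspaceI)
      show "0 \<in> Q" using QI[of 0 0] zero by simp
    next
      fix p q assume "p \<in> Q" "q \<in> Q"
      then obtain x y x' y' where
        "p = x + y" "x \<in> G 0" "y \<in> G 1" "h * x = x * h" "h * y = y * parity h"
        "q = x' + y'" "x' \<in> G 0" "y' \<in> G 1" "h * x' = x' * h" "h * y' = y' * parity h"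
        unfolding Q_def by blast
      then show "p + q \<in> Q"
        using QI[of "x + x'" "y + y'"] subspace_even subspace_odd
        by (simp add: subspace_add algebra_simps)
    next
      fix t p assume "p \<in> Q"
      then obtain x y where
        "p = x + y" "x \<in> G 0" "y \<in> G 1" "h * x = x * h" "h * y = y * parity h"
        unfolding Q_def by blast
      then show "scl t p \<in> Q"
        using QI[of "scl t x" "scl t y"] subspace_even subspace_odd
        by (simp add: subspace_scale scale_mult_left scale_mult_right scale_right_distrib)
    qed
    show "1 \<in> Q" using QI[of 1 0] zero one_even by simp
  next
    fix p q assume "p \<in> Q" "q \<in> Q"
    then obtain x y x' y' where p:
      "p = x + y" "x \<in> G 0" "y \<in> G 1" "h * x = x * h" "h * y = y * parity h"
      and q: "q = x' + y'" "x' \<in> G 0" "y' \<in> G 1" "h * x' = x' * h" "h * y' = y' * parity h"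
      unfolding Q_def by blast
    \<comment> \<open>An odd factor replaces \<open>h\<close> by \<open>parity h\<close>, so the
      relations for \<open>parity h\<close> are needed as well. They arise by applying the
      automorphism \<open>parity\<close> to those for \<open>h\<close>.\<close>
    have x': "parity h * x' = x' * parity h"
      using arg_cong[OF q(4), of parity] q(2) by (simp add: parity_mult parity_even)
    have y': "parity h * y' = y' * h"
      using arg_cong[OF q(5), of parity] q(3) by (simp add: parity_mult parity_odd)
    have "h * (x * x' + y * y') = (x * x' + y * y') * h"
      "h * (x * y' + y * x') = (x * y' + y * x') * parity h"
      using p q x' y' by (simp_all add: distrib_left distrib_right flip: mult.assoc)
        (simp_all add: mult.assoc)
    moreover have "x * x' + y * y' \<in> G 0" "x * y' + y * x' \<in> G 1"
      using p q mult_graded[of 0 0] mult_graded[of 1 1] mult_graded[of 0 1] mult_graded[of 1 0]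
        subspace_even subspace_odd by (auto intro!: subspace_add)
    ultimately have "(x * x' + y * y') + (x * y' + y * x') \<in> Q"
      by (intro QI)
    then show "p * q \<in> Q" by (simp add: p q algebra_simps)
  qed
  moreover have "B \<subseteq> Q"
    using gens QI[of _ 0] QI[of 0] zero by fastforce
  ultimately have "s \<in> Q"
    using s unfolding hull_def by blast
  then show ?thesis
    unfolding Q_def supercommute_iff by (auto simp: component_eqI[OF _ _ refl] algebra_simps)
qed

lemma is_subalgebra_hull: "is_subalgebra scl (is_subalgebra scl hull B)"
  unfolding hull_def
  by (subst is_subalgebra_def, unfold subspace_def)
    (auto simp: is_subalgebra_def subspace_def)

end

section \<open>The Dirac element\<close>

lemma reflection_along_bij:
  assumes "\<alpha> \<noteq> 0"
  shows "reflection_along \<alpha> \<in> Bij UNIV"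
proof -
  have "reflection_along \<alpha> (reflection_along \<alpha> x) = x" for x
    using assms by (simp add: reflection_along_def inner_diff_left algebra_simps)
  then have "bij (reflection_along \<alpha>)"
    by (intro o_bij[of "reflection_along \<alpha>"]) (auto simp: fun_eq_iff)
  then show ?thesis by (simp add: Bij_def)
qed

text \<open>Translates the subgroup of \<open>BijGroup UNIV\<close> generated by the reflections
  into closure under plain composition and \<open>inv_into\<close>, the operations in which the
  relations of the algebra are stated.\<close>

lemma finite_reflection_group_closed:
  assumes "finite_reflection_group W"
  shows "id \<in> W"
    and "w \<in> W \<Longrightarrow> bij w"
    and "w \<in> W \<Longrightarrow> inv_into UNIV w \<in> W"
    and "u \<in> W \<Longrightarrow> w \<in> W \<Longrightarrow> u \<circ> w \<in> W"
proof -
  interpret B: group "BijGroup (UNIV :: 'a set)" by (rule group_BijGroup)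
  obtain R where "0 \<notin> R" and W: "W = generate (BijGroup UNIV) (reflection_along ` R)"
    using assms unfolding finite_reflection_group_def by blast
  then have gens: "reflection_along ` R \<subseteq> carrier (BijGroup UNIV)"
    by (auto simp: BijGroup_def intro!: reflection_along_bij)
  interpret W: subgroup W "BijGroup UNIV"
    unfolding W by (rule B.generate_is_subgroup[OF gens])
  show "id \<in> W"
    using W.one_closed by (simp add: BijGroup_def id_def restrict_UNIV)
  show bij: "bij w" if "w \<in> W" for w
    using W.subset that by (auto simp: BijGroup_def Bij_def)
  show "u \<circ> w \<in> W" if "u \<in> W" "w \<in> W"
    using W.m_closed[OF that] bij that
    by (simp add: BijGroup_def Bij_def compose_def comp_def restrict_UNIV)
  show "inv_into UNIV w \<in> W" if "w \<in> W"
  proof -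
    have "inv\<^bsub>BijGroup UNIV\<^esub> w \<in> W" using that by (rule W.m_inv_closed)
    moreover have "inv\<^bsub>BijGroup UNIV\<^esub> w = inv_into UNIV w"
    proof (rule B.inv_equality)
      show "inv_into UNIV w \<otimes>\<^bsub>BijGroup UNIV\<^esub> w = \<one>\<^bsub>BijGroup UNIV\<^esub>"
        using bij[OF that]
        by (auto simp: BijGroup_def Bij_def compose_def fun_eq_iff bij_imp_bij_inv bij_is_inj)
    qed (use bij[OF that] in \<open>auto simp: BijGroup_def Bij_def bij_imp_bij_inv\<close>)
    ultimately show ?thesis by simp
  qed
qed

context hecke_clifford
begin

lemmas id_in_W = finite_reflection_group_closed(1)[OF reflection_group]
  and bij_W = finite_reflection_group_closed(2)[OF reflection_group]
  and inv_in_W = finite_reflection_group_closed(3)[OF reflection_group]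
  and comp_in_W = finite_reflection_group_closed(4)[OF reflection_group]

lemma finite_W: "finite W"
  using reflection_group unfolding finite_reflection_group_def by blast

lemma f_inv:
  assumes "w \<in> W"
  shows "f w * f (inv_into UNIV w) = 1" "f (inv_into UNIV w) * f w = 1"
  using assms f_comp inv_in_W bij_W f_id
  by (simp_all flip: f_comp add: bij_is_surj bij_is_inj surj_iff[THEN iffD1] inj_iff[THEN iffD1])

lemma f_inv_cancel:
  assumes "w \<in> W"
  shows "f w * (f (inv_into UNIV w) * x) = x" "f (inv_into UNIV w) * (f w * x) = x"
  using f_inv[OF assms] by (simp_all flip: mult.assoc)

text \<open>In the zero ring the monomial with trivial exponents would be 0, but it belongs to an
  independent set.\<close>

lemma one_neq_zero: "(1::'h) \<noteq> 0"
proof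
  assume "(1::'h) = 0"
  then have zero: "x = 0" for x :: 'h by (metis mult_1 mult_zero_left)
  define p where "p = ((\<lambda>i\<in>{1..n}. 0 :: nat), (\<lambda>i\<in>{1..n}. 0 :: nat), id :: 'e \<Rightarrow> 'e)"
  have "p \<in> pbw_index n W"
    unfolding p_def pbw_index_def using id_in_W by auto
  then have "0 \<in> pbw_monomial n f c a ` pbw_index n W"
    using zero by (metis imageI)
  then show False
    using dependent_zero pbw_independent by blast
qed

section \<open>The matrices of the group action and the Clifford relations\<close>

text \<open>The matrix of \<open>\<rho> w\<close>, row index first. The same matrix governs moving
  \<open>f w\<close> past the \<open>a i\<close> and past the \<open>c i\<close>.\<close>

definition entry :: "('e \<Rightarrow> 'e) \<Rightarrow> nat \<Rightarrow> nat \<Rightarrow> complex" where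
  "entry w j i = complex_of_real (real_vector.representation (v ` {1..n}) (\<rho> w (v i)) (v j))"

lemma f_mult_c:
  assumes "w \<in> W" "i \<in> {1..n}"
  shows "f w * c i = (\<Sum>j=1..n. scl (entry w j i) (c j * f w))"
  using w_c[OF assms] by (simp add: basis_map_def entry_def sum_distrib_right scale_mult_left)

lemma f_mult_a:
  assumes "w \<in> W" "i \<in> {1..n}"
  shows "f w * a i = (\<Sum>j=1..n. scl (entry w j i) (a j * f w))"
proof -
  have "f w * a i = f w * a i * f (inv_into UNIV w) * f w"
    using f_inv[OF assms(1)] by (simp add: mult.assoc)
  then show ?thesis
    using w_a[OF assms] by (simp add: basis_map_def entry_def sum_distrib_right scale_mult_left)
qed

lemma f_mult_c_assoc:
  assumes "w \<in> W" "i \<in> {1..n}"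
  shows "f w * (c i * x) = (\<Sum>j=1..n. scl (entry w j i) (c j * (f w * x)))"
  using arg_cong[OF f_mult_c[OF assms], of "\<lambda>y. y * x"]
  by (simp add: sum_distrib_right scale_mult_left mult.assoc)

lemma f_mult_a_assoc:
  assumes "w \<in> W" "i \<in> {1..n}"
  shows "f w * (a i * x) = (\<Sum>j=1..n. scl (entry w j i) (a j * (f w * x)))"
  using arg_cong[OF f_mult_a[OF assms], of "\<lambda>y. y * x"]
  by (simp add: sum_distrib_right scale_mult_left mult.assoc)

lemma c_square': "i \<in> {1..n} \<Longrightarrow> c i * c i = -1"
  using c_square by (simp add: power2_eq_square)

lemma c_c_cancel: "i \<in> {1..n} \<Longrightarrow> c i * (c i * x) = - x"
  using c_square'[of i] by (simp flip: mult.assoc)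

text \<open>All terms with \<open>k\<close> \<noteq> \<open>l\<close> anticommute away, so the
  anticommutator with \<open>c l\<close> reads off the coefficient at \<open>l\<close>.\<close>

lemma anticommutator_sum_c:
  assumes "l \<in> {1..n}"
  shows "c l * (\<Sum>k=1..n. scl (t k) (c k)) + (\<Sum>k=1..n. scl (t k) (c k)) * c l = scl (- 2 * t l) 1"
proof -
  have "c l * (\<Sum>k=1..n. scl (t k) (c k)) + (\<Sum>k=1..n. scl (t k) (c k)) * c l
    = (\<Sum>k=1..n. scl (t k) (c l * c k + c k * c l))"
    by (simp add: sum_distrib_left sum_distrib_right scale_mult_left scale_mult_right
        scale_right_distrib sum.distrib)
  also have "\<dots> = (\<Sum>k=1..n. if k = l then scl (t l) (-1 + -1) else 0)"
    using assms by (intro sum.cong) (auto simp: c_square' c_c[of l] simp del: scale_minus_right)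
  also have "\<dots> = scl (t l) (-1 + -1)" using assms by simp
  also have "\<dots> = scl (- 2 * t l) 1"
    by (simp only: scale_right_distrib scale_minus_right flip: scale_left_distrib scale_minus_left)
      simp
  finally show ?thesis .
qed

lemma conj_c:
  assumes "w \<in> W" "i \<in> {1..n}"
  shows "f w * c i * f (inv_into UNIV w) = (\<Sum>j=1..n. scl (entry w j i) (c j))"
  using assms by (simp add: f_mult_c sum_distrib_right scale_mult_left mult.assoc f_inv)

lemma conj_inv_c:
  assumes "w \<in> W" "i \<in> {1..n}"
  shows "f (inv_into UNIV w) * c i * f w = (\<Sum>j=1..n. scl (entry (inv_into UNIV w) j i) (c j))"
  using conj_c[OF inv_in_W assms(2), OF assms(1)] bij_W[OF assms(1)]
  by (simp add: inv_inv_eq)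

text \<open>The basis \<open>v\<close> need not be normalised. That \<open>\<rho> w\<close> nevertheless has an orthogonal matrix is
  forced by the Clifford relations, because conjugation by \<open>f w\<close> preserves anticommutators.\<close>

lemma entry_inv:
  assumes w: "w \<in> W" and i: "i \<in> {1..n}" and l: "l \<in> {1..n}"
  shows "entry (inv_into UNIV w) i l = entry w l i"
proof -
  define g where "g = f (inv_into UNIV w)"
  \<comment> \<open>The scalar is an anticommutator of \<open>c i\<close> with a conjugate of
    \<open>c l\<close>. Pulling the conjugation outside turns it into the anticommutator of
    \<open>c l\<close> with a conjugate of \<open>c i\<close>.\<close>
  have "scl (- 2 * entry (inv_into UNIV w) i l) 1 = c i * (g * c l * f w) + g * c l * f w * c i"
    unfolding g_def conj_inv_c[OF w l] anticommutator_sum_c[OF i] ..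
  also have "\<dots> = g * (c l * (f w * c i * g) + (f w * c i * g) * c l) * f w"
    unfolding g_def by (simp add: algebra_simps f_inv_cancel[OF w] f_inv[OF w])
  also have "\<dots> = scl (- 2 * entry w l i) 1"
    unfolding g_def conj_c[OF w i] anticommutator_sum_c[OF l]
    by (simp add: mult_scale_one scale_mult_left f_inv[OF w])
  finally show ?thesis
    using one_neq_zero by simp
qed

abbreviation D :: 'h where "D \<equiv> dirac n a c"

text \<open>Each summand \<open>a i * c i\<close> contributes exactly one sign: from crossing
  \<open>a i\<close> if \<open>i = j\<close>, and from crossing \<open>c i\<close>
  otherwise.\<close>

lemma c_mult_D:
  assumes "j \<in> {1..n}"
  shows "c j * D = - (D * c j)"
proof -
  have "c j * (a i * c i) = - (a i * c i * c j)" if "i \<in> {1..n}" for i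
  proof (cases "i = j")
    case True
    then show ?thesis using c_a_same[OF assms] by (simp flip: mult.assoc)
  next
    case False
    then show ?thesis using c_a[OF that assms] c_c[OF assms that]
      by (metis mult.assoc mult_minus_right)
  qed
  then show ?thesis
    unfolding dirac_def by (simp add: sum_distrib_left sum_distrib_right sum_negf)
qed

text \<open>Moving \<open>f w\<close> past \<open>a i\<close> produces a column of its matrix. By
  \<open>entry_inv\<close> the sum over \<open>i\<close> can be read as the conjugate of
  \<open>c j\<close> by the inverse of \<open>w\<close>, which the remaining \<open>f w\<close>
  undoes.\<close>

lemma f_mult_D:
  assumes w: "w \<in> W"
  shows "f w * D = D * f w"
proof -
  have "f w * D = (\<Sum>i=1..n. \<Sum>j=1..n. scl (entry w j i) (a j * (f w * c i)))"
    unfolding dirac_def sum_distrib_left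
    by (intro sum.cong refl)
      (simp add: f_mult_a_assoc[OF w])
  also have "\<dots> = (\<Sum>j=1..n. \<Sum>i=1..n. scl (entry w j i) (a j * (f w * c i)))"
    by (rule sum.swap)
  also have "\<dots> = (\<Sum>j=1..n. a j * (f w * (\<Sum>i=1..n. scl (entry (inv_into UNIV w) i j) (c i))))"
    by (intro sum.cong refl) (simp add: sum_distrib_left scale_mult_right entry_inv[OF w])
  also have "\<dots> = (\<Sum>j=1..n. a j * (c j * f w))"
    by (intro sum.cong refl) (simp add: f_inv_cancel[OF w] mult.assoc flip: conj_inv_c[OF w])
  finally show ?thesis
    by (simp add: dirac_def sum_distrib_right mult.assoc)
qed

lemma D_odd: "parity D = - D"
  unfolding dirac_def
  by (simp add: parity_mult parity_even parity_odd a_even c_odd sum_negf)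

section \<open>The subalgebra Seg(W) and the linearity of \<open>d\<close> over it\<close>

abbreviation S :: "'h set" where "S \<equiv> Seg scl W n f c"

lemma subalgebra_S: "is_subalgebra scl S"
  unfolding Seg_def by (rule is_subalgebra_hull)

lemma S_closed [simp]:
  "0 \<in> S" "1 \<in> S"
  "x \<in> S \<Longrightarrow> scl t x \<in> S" "x \<in> S \<Longrightarrow> y \<in> S \<Longrightarrow> x + y \<in> S"
  "x \<in> S \<Longrightarrow> y \<in> S \<Longrightarrow> x * y \<in> S" "x \<in> S \<Longrightarrow> - x \<in> S"
  "x \<in> S \<Longrightarrow> y \<in> S \<Longrightarrow> x - y \<in> S"
  using subalgebra_S unfolding is_subalgebra_def
  by (auto intro: subspace_0 subspace_scale subspace_add subspace_diff subspace_neg)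

lemma f_in_S [simp]: "w \<in> W \<Longrightarrow> f w \<in> S" and c_in_S [simp]: "i \<in> {1..n} \<Longrightarrow> c i \<in> S"
  unfolding Seg_def by (auto intro: hull_inc)

lemma S_subset:
  assumes "is_subalgebra scl T" "\<And>w. w \<in> W \<Longrightarrow> f w \<in> T" "\<And>i. i \<in> {1..n} \<Longrightarrow> c i \<in> T"
  shows "S \<subseteq> T"
  unfolding Seg_def by (rule hull_minimal) (use assms in auto)

lemma S_induct [consumes 1, case_names f c one add scale mult]:
  assumes "s \<in> S" and "\<And>w. w \<in> W \<Longrightarrow> Q (f w)" and "\<And>i. i \<in> {1..n} \<Longrightarrow> Q (c i)" and "Q 1"
    and "\<And>x y. x \<in> S \<Longrightarrow> y \<in> S \<Longrightarrow> Q x \<Longrightarrow> Q y \<Longrightarrow> Q (x + y)"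
    and "\<And>t x. x \<in> S \<Longrightarrow> Q x \<Longrightarrow> Q (scl t x)"
    and "\<And>x y. x \<in> S \<Longrightarrow> y \<in> S \<Longrightarrow> Q x \<Longrightarrow> Q y \<Longrightarrow> Q (x * y)"
  shows "Q s"
proof -
  have "Q 0" using assms(6)[of 1 0] assms(4) by simp
  then have "is_subalgebra scl {s \<in> S. Q s}"
    unfolding is_subalgebra_def subspace_def using assms(4-7) by simp
  then have "S \<subseteq> {s \<in> S. Q s}"
    using assms(2,3) by (intro S_subset) auto
  then show ?thesis using assms(1) by blast
qed

text \<open>Seg(W) is graded because its generators are homogeneous.\<close>

lemma parity_in_S [simp]: "s \<in> S \<Longrightarrow> parity s \<in> S"
  by (induction rule: S_induct)
    (simp_all add: parity_even parity_odd f_even c_odd one_even parity_add parity_scale parity_mult)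

text \<open>The generators are covered by \<open>f_mult_D\<close> and \<open>c_mult_D\<close>;
  products follow because \<open>parity\<close> is multiplicative. Consequently \<open>d\<close>
  kills Seg(W) and is linear over it, up to a parity on the left.\<close>

lemma D_mult_S: "s \<in> S \<Longrightarrow> D * s = parity s * D"
proof (induction rule: S_induct)
  case (mult x y)
  then have "D * (x * y) = parity x * D * y" by (simp flip: mult.assoc)
  also have "\<dots> = parity x * parity y * D" using mult by (simp add: mult.assoc)
  finally show ?case by (simp add: parity_mult)
qed (simp_all add: parity_even parity_odd f_even c_odd one_even parity_add parity_scale
    f_mult_D c_mult_D distrib_left distrib_right scale_mult_left scale_mult_right)

abbreviation d :: "'h \<Rightarrow> 'h" where "d \<equiv> dirac_d G D"

lemma linear_d: "is_linear d"
  by (rule is_linearI) (simp_all add: dirac_d_eq parity_add parity_scale algebra_simps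
      scale_mult_left scale_mult_right scale_right_diff_distrib)

lemma d_add: "d (x + y) = d x + d y" and d_diff: "d (x - y) = d x - d y"
  and d_scale: "d (scl t x) = scl t (d x)" and d_0: "d 0 = 0" and d_minus: "d (- x) = - d x"
  and d_sum: "d (sum g A) = (\<Sum>i\<in>A. d (g i))"
proof -
  interpret d: Vector_Spaces.linear scl scl d by (rule linear_d)
  show "d (x + y) = d x + d y" "d (x - y) = d x - d y" "d (scl t x) = scl t (d x)" "d 0 = 0"
    "d (- x) = - d x" "d (sum g A) = (\<Sum>i\<in>A. d (g i))"
    by (rule d.add d.diff d.scale d.zero d.neg d.sum)+
qed

lemma d_S: "s \<in> S \<Longrightarrow> d s = 0"
  by (simp add: dirac_d_eq D_mult_S)

lemma d_mult_S: "s \<in> S \<Longrightarrow> d (h * s) = d h * s"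
  by (simp add: dirac_d_eq parity_mult algebra_simps D_mult_S)

lemma d_S_mult: "s \<in> S \<Longrightarrow> d (s * h) = parity s * d h"
  by (simp add: dirac_d_eq parity_mult algebra_simps flip: mult.assoc D_mult_S)

lemma parity_d: "parity (d h) = - d (parity h)"
  by (simp add: dirac_d_eq parity_mult D_odd)

subsection \<open>The filtration by degree\<close>

text \<open>Sums of words with at most \<open>m\<close> letters \<open>a i\<close>, each followed by
  an element of Seg(W). The letters are left unordered, so that left multiplication by
  \<open>a i\<close> needs no reordering.\<close>

inductive filt :: "nat \<Rightarrow> 'h \<Rightarrow> bool" where
  filt_S: "s \<in> S \<Longrightarrow> filt m s"
| filt_add: "filt m x \<Longrightarrow> filt m y \<Longrightarrow> filt m (x + y)"
| filt_a: "i \<in> {1..n} \<Longrightarrow> filt m x \<Longrightarrow> filt (Suc m) (a i * x)"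

lemma filt_scale: "filt m x \<Longrightarrow> filt m (scl t x)"
proof (induction rule: filt.induct)
  case (filt_a i m x)
  then show ?case using filt.filt_a[of i m "scl t x"] by (simp add: scale_mult_right)
qed (auto intro: filt.intros simp: scale_right_distrib)

lemma filt_minus: "filt m x \<Longrightarrow> filt m (- x)"
  using filt_scale[of m x "-1"] by simp

lemma filt_diff: "filt m x \<Longrightarrow> filt m y \<Longrightarrow> filt m (x - y)"
  using filt_add[OF _ filt_minus] by fastforce

lemma filt_0: "filt m 0"
  by (intro filt_S) simp

lemma filt_sum: "(\<And>i. i \<in> A \<Longrightarrow> filt m (g i)) \<Longrightarrow> filt m (sum g A)"
  by (induction A rule: infinite_finite_induct) (auto intro: filt_0 filt_add)

lemma filt_mono:
  assumes "filt m x" "m \<le> m'"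
  shows "filt m' x"
proof -
  have "filt (m + k) x" for k
    using assms(1) by (induction rule: filt.induct) (auto intro: filt.intros)
  then show ?thesis using assms(2) le_Suc_ex by blast
qed

lemma filt_0_iff: "filt 0 x \<longleftrightarrow> x \<in> S"
proof
  show "x \<in> S" if "filt 0 x"
    using that by (induction "0 :: nat" x rule: filt.induct) auto
qed (rule filt_S)

lemma subspace_filt: "subspace {x. filt m x}"
  by (rule subspaceI) (auto intro: filt_0 filt_add filt_scale)

text \<open>Generators of Seg(W) move to the right past each letter \<open>a i\<close> without
  changing the number of letters: \<open>f w\<close> through its matrix, \<open>c j\<close> up to a
  sign.\<close>

lemma filt_S_mult:
  assumes "s \<in> S" "filt m x"
  shows "filt m (s * x)"
  using assms
proof (induction arbitrary: m x rule: S_induct)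
  case (f w)
  from f(2,1) show ?case
  proof (induction rule: filt.induct)
    case (filt_a i m x)
    have "f w * (a i * x) = (\<Sum>j=1..n. scl (entry w j i) (a j * (f w * x)))"
      using filt_a by (simp add: f_mult_a_assoc)
    then show ?case using filt_a by (auto intro!: filt_sum filt_scale filt.filt_a)
  qed (auto intro: filt.intros simp: distrib_left)
next
  case (c j)
  from c(2,1) show ?case
  proof (induction rule: filt.induct)
    case (filt_a i m x)
    have "c j * (a i * x) = a i * (c j * x) \<or> c j * (a i * x) = - (a i * (c j * x))"
      using c_a[of i j] c_a_same[of i] filt_a
      by (cases "i = j") (simp_all add: mult.assoc flip: mult.assoc[of "c j"])
    then show ?case using filt_a by (metis filt_minus filt.filt_a)
  qed (auto intro: filt.intros simp: distrib_left)
next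
  case (mult y z)
  then show ?case by (simp add: mult.assoc)
qed (auto intro: filt_add filt_scale simp: distrib_right scale_mult_left)

lemma filt_mult: "filt m x \<Longrightarrow> filt m' y \<Longrightarrow> filt (m + m') (x * y)"
proof (induction arbitrary: m' y rule: filt.induct)
  case (filt_S s m)
  then show ?case using filt_mono[OF filt_S_mult] by simp
next
  case (filt_a i m x)
  then show ?case using filt.filt_a[of i] by (simp add: mult.assoc)
qed (auto intro: filt_add simp: distrib_right)

lemma filt_mult_S: "filt m x \<Longrightarrow> s \<in> S \<Longrightarrow> filt m (x * s)"
  using filt_mult[of m x 0 s] filt_S by simp

lemma filt_parity: "filt m x \<Longrightarrow> filt m (parity x)"
  by (induction rule: filt.induct)
    (auto intro: filt.intros simp: parity_add parity_mult parity_even[OF a_even])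

lemma filt_generator_a: "i \<in> {1..n} \<Longrightarrow> filt 1 (a i)"
  using filt_a[of i 0 1] filt_S[of 1] by (simp add: One_nat_def)

text \<open>The elements of finite degree form a subalgebra containing all generators.\<close>

lemma filt_exhaust: "\<exists>m. filt m x"
proof -
  have "is_subalgebra scl {x. \<exists>m. filt m x}"
    unfolding is_subalgebra_def
  proof (intro conjI ballI)
    show "subspace {x. \<exists>m. filt m x}"
    proof (rule subspaceI; clarsimp?)
      show "\<exists>m. filt m 0" using filt_0 by blast
    next
      fix x y m m' assume "filt m x" "filt m' y"
      then have "filt (max m m') (x + y)"
        by (intro filt_add) (auto elim: filt_mono)
      then show "\<exists>m. filt m (x + y)" ..
    qed (auto intro: filt_scale)
  next
    show "1 \<in> {x. \<exists>m. filt m x}" using filt_S[of 1] by auto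
  next
    fix x y assume "x \<in> {x. \<exists>m. filt m x}" "y \<in> {x. \<exists>m. filt m x}"
    then show "x * y \<in> {x. \<exists>m. filt m x}" using filt_mult by blast
  qed
  moreover have "f ` W \<union> c ` {1..n} \<union> a ` {1..n} \<subseteq> {x. \<exists>m. filt m x}"
    using filt_generator_a filt_S[OF f_in_S] filt_S[OF c_in_S] by blast
  ultimately have "is_subalgebra scl hull (f ` W \<union> c ` {1..n} \<union> a ` {1..n}) \<subseteq> {x. \<exists>m. filt m x}"
    by (intro hull_minimal)
  then show ?thesis using generated by blast
qed

section \<open>Ordered monomials in the \<open>a i\<close> modulo lower degree\<close>

text \<open>For \<open>i\<close> \<noteq> \<open>j\<close> the element \<open>c j * c i\<close> is
  inverse to \<open>c i * c j\<close>, so these factors can be cancelled from the defining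
  relation.\<close>

lemma a_commutator_in_S:
  assumes "i \<in> {1..n}" "j \<in> {1..n}"
  shows "a i * a j - a j * a i \<in> S"
proof (cases "i = j")
  case False
  have "(a i * a j - a j * a i) * c i * c j * (c j * c i) \<in> S"
    using a_a[OF assms False] assms by simp
  moreover have "(a i * a j - a j * a i) * c i * c j * (c j * c i) = a i * a j - a j * a i"
    using assms by (simp only: mult.assoc c_c_cancel mult_minus_right c_square') simp
  ultimately show ?thesis by simp
qed simp

text \<open>Crossing one more letter costs a commutator of two letters, which has degree 0 instead
  of 2. This is the induction step showing that the \<open>a i\<close> commute modulo lower
  degree.\<close>

lemma filt_commutator:
  assumes "i \<in> {1..n}" "filt m x" "filt m (a i * x - x * a i)" "j \<in> {1..n}"
  shows "filt (Suc m) (a i * (a j * x) - a j * x * a i)"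
proof -
  have "a i * (a j * x) - a j * x * a i
    = (a i * a j - a j * a i) * x + a j * (a i * x - x * a i)"
    by (simp add: algebra_simps)
  moreover have "filt (Suc m) ((a i * a j - a j * a i) * x)"
    using filt_mono[OF filt_S_mult[OF a_commutator_in_S]] assms by simp
  ultimately show ?thesis
    using assms by (metis filt_add filt_a)
qed

text \<open>Indexed by a list, so that the ordered product can be split at a chosen
  variable.\<close>

definition apow :: "(nat \<Rightarrow> nat) \<Rightarrow> nat list \<Rightarrow> 'h" where
  "apow k l = prod_list (map (\<lambda>i. a i ^ k i) l)"

lemma apow_simps: "apow k [] = 1" "apow k (i # l) = a i ^ k i * apow k l"
  "apow k (l @ l') = apow k l * apow k l'"
  by (simp_all add: apow_def)

lemma apow_cong: "(\<And>i. i \<in> set l \<Longrightarrow> k i = k' i) \<Longrightarrow> apow k l = apow k' l"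
  unfolding apow_def by (intro arg_cong[where f = prod_list] map_cong) auto

lemma filt_apow:
  assumes "set l \<subseteq> {1..n}" "i \<in> {1..n}"
  shows "filt (sum_list (map k l)) (apow k l)"
    and "filt (sum_list (map k l)) (a i * apow k l - apow k l * a i)"
proof -
  \<comment> \<open>Both bounds run through one induction, because the bound on the commutator uses
    the bound on the monomial.\<close>
  have power: "filt (p + m) (a j ^ p * x) \<and> filt (p + m) (a i * (a j ^ p * x) - a j ^ p * x * a i)"
    if "filt m x" "filt m (a i * x - x * a i)" "j \<in> {1..n}" for p m j x
    using that(1,2)
  proof (induction p)
    case (Suc p)
    then show ?case
      using filt_a[OF that(3)] filt_commutator[OF assms(2), of "p + m" "a j ^ p * x" j] that(3)
      by (simp add: mult.assoc)
  qed simp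
  have "filt (sum_list (map k l)) (apow k l) \<and>
    filt (sum_list (map k l)) (a i * apow k l - apow k l * a i)"
    using assms(1)
  proof (induction l)
    case (Cons j l)
    then show ?case
      using power[of "sum_list (map k l)" "apow k l" j "k j"] by (simp add: apow_simps)
  qed (simp add: apow_simps filt_S filt_0)
  then show "filt (sum_list (map k l)) (apow k l)"
    "filt (sum_list (map k l)) (a i * apow k l - apow k l * a i)" by simp_all
qed

abbreviation A :: "(nat \<Rightarrow> nat) \<Rightarrow> 'h" where "A k \<equiv> apow k [1..<Suc n]"

definition deg :: "(nat \<Rightarrow> nat) \<Rightarrow> nat" where "deg k = sum k {1..n}"

lemma deg_eq_sum_list: "deg k = sum_list (map k [1..<Suc n])"
  unfolding deg_def
  by (simp only: interv_sum_list_conv_sum_set_nat set_upt atLeastLessThanSuc_atLeastAtMost)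

text \<open>Stated additively to avoid truncated subtraction.\<close>

lemma deg_upd:
  assumes "i \<in> {1..n}"
  shows "deg (k(i := m)) + k i = deg k + m"
  using assms unfolding deg_def by (simp add: sum.remove[of _ i])

lemma filt_A: "filt (deg k) (A k)" and filt_A_commutator:
  "i \<in> {1..n} \<Longrightarrow> filt (deg k) (a i * A k - A k * a i)"
proof -
  have "set [1..<Suc n] \<subseteq> {1..n}" by auto
  then show "i \<in> {1..n} \<Longrightarrow> filt (deg k) (a i * A k - A k * a i)"
    unfolding deg_eq_sum_list by (rule filt_apow)
  \<comment> \<open>\<open>filt_apow\<close> asks for an index in \<open>{1..n}\<close>; for
    \<open>n = 0\<close> there is none, and the monomial is 1.\<close>
  show "filt (deg k) (A k)"
  proof (cases "n = 0")
    case True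
    then have "A k = 1" by (simp add: apow_simps)
    then show ?thesis by (simp add: filt_S)
  next
    case False
    then show ?thesis
      unfolding deg_eq_sum_list
      by (intro filt_apow(1)[of _ 1]) (use False in auto)
  qed
qed

text \<open>Only the factors preceding the power of \<open>a i\<close> have to be crossed, and the
  resulting commutator loses one degree.\<close>

lemma filt_a_mult_A:
  assumes "i \<in> {1..n}"
  shows "filt (deg k) (a i * A k - A (k(i := Suc (k i))))"
proof -
  define xs ys where "xs = [1..<i]" and "ys = [Suc i..<Suc n]"
  have l: "[1..<Suc n] = xs @ i # ys"
    using assms upt_add_eq_append[of 1 i "Suc n - i"] by (simp add: xs_def ys_def upt_conv_Cons)
  have sets: "set xs \<subseteq> {1..n}" "set ys \<subseteq> {1..n}" "i \<notin> set xs" "i \<notin> set ys"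
    using assms by (auto simp: xs_def ys_def)
  have "A (k(i := Suc (k i))) = apow k xs * (a i * (a i ^ k i * apow k ys))"
  proof -
    have "apow (k(i := Suc (k i))) xs = apow k xs" "apow (k(i := Suc (k i))) ys = apow k ys"
      using sets by (auto intro: apow_cong)
    then show ?thesis unfolding l by (simp add: apow_simps mult.assoc)
  qed
  then have "a i * A k - A (k(i := Suc (k i)))
    = (a i * apow k xs - apow k xs * a i) * apow k (i # ys)"
    unfolding l by (simp add: apow_simps algebra_simps)
  moreover have "filt (deg k) ((a i * apow k xs - apow k xs * a i) * apow k (i # ys))"
    unfolding deg_eq_sum_list l map_append sum_list_append
    by (intro filt_mult filt_apow) (use sets assms in auto)
  ultimately show ?thesis by simp
qed

lemma filt_A_mult_a:
  assumes "i \<in> {1..n}"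
  shows "filt (deg k) (A k * a i - A (k(i := Suc (k i))))"
  using filt_diff[OF filt_a_mult_A[OF assms, of k] filt_A_commutator[OF assms, of k]] by simp

lemma neg_one_power_mult_left: "x * ((- 1) ^ p * y) = (- 1) ^ p * (x * y)" for x y :: 'h
  by (cases "even p") simp_all

text \<open>Among the letters, \<open>c i\<close> anticommutes with \<open>a i\<close> and commutes
  with the others, so only the exponent of \<open>a i\<close> enters the sign.\<close>

lemma c_mult_A:
  assumes "i \<in> {1..n}"
  shows "c i * A k = (- 1) ^ k i * (A k * c i)"
proof -
  have power: "c i * a j ^ p = (if j = i then (- 1) ^ p else 1) * (a j ^ p * c i)"
    if "j \<in> {1..n}" for j p
  proof (induction p)
    case (Suc p)
    have "c i * a j = (if j = i then - 1 else 1) * (a j * c i)"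
      using c_a[of j i] c_a_same[of i] assms that by (cases "j = i") simp_all
    then have "c i * a j ^ Suc p = (if j = i then - 1 else 1) * (a j * (c i * a j ^ p))"
      by (simp add: mult.assoc flip: mult.assoc[of "c i"])
    then show ?case
      unfolding Suc by (auto simp: mult.assoc neg_one_power_mult_left)
  qed simp
  have "c i * apow k l = (if i \<in> set l then (- 1) ^ k i else 1) * (apow k l * c i)"
    if "set l \<subseteq> {1..n}" "distinct l" for l
    using that
  proof (induction l)
    case (Cons j l)
    have "c i * apow k (j # l) = (if j = i then (- 1) ^ k j else 1) * (a j ^ k j * (c i * apow k l))"
      using power[of j "k j"] Cons.prems by (simp add: apow_simps mult.assoc flip: mult.assoc[of "c i"])
    then show ?case
      using Cons by (cases "j = i") (simp_all add: apow_simps mult.assoc neg_one_power_mult_left)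
  qed (simp add: apow_simps)
  moreover have "set [1..<Suc n] \<subseteq> {1..n}" "i \<in> set [1..<Suc n]" using assms by auto
  ultimately show ?thesis by (metis distinct_upt)
qed

subsection \<open>The contracting homotopy\<close>

declare upt_Suc [simp del]

section \<open>Spanning sets for Seg(W) and for the filtration steps\<close>

definition cpow :: "(nat \<Rightarrow> nat) \<Rightarrow> nat list \<Rightarrow> 'h" where
  "cpow \<epsilon> l = prod_list (map (\<lambda>i. c i ^ \<epsilon> i) l)"

lemma cpow_simps: "cpow \<epsilon> [] = 1" "cpow \<epsilon> (i # l) = c i ^ \<epsilon> i * cpow \<epsilon> l"
  by (simp_all add: cpow_def)

lemma cpow_cong: "(\<And>i. i \<in> set l \<Longrightarrow> \<epsilon> i = \<epsilon>' i) \<Longrightarrow> cpow \<epsilon> l = cpow \<epsilon>' l"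
  unfolding cpow_def by (intro arg_cong[where f = prod_list] map_cong) auto

abbreviation C :: "(nat \<Rightarrow> nat) \<Rightarrow> 'h" where "C \<epsilon> \<equiv> cpow \<epsilon> [1..<Suc n]"

text \<open>Since \<open>c i\<close> squares to -1, it toggles the exponent at \<open>i\<close>. The
  spanning argument below does not need the sign, so only its existence is recorded.\<close>

lemma c_mult_cpow:
  assumes "i \<in> set l" "set l \<subseteq> {1..n}" "distinct l" "\<epsilon> i \<in> {0, 1}"
  shows "\<exists>t. c i * cpow \<epsilon> l = scl t (cpow (\<epsilon>(i := 1 - \<epsilon> i)) l)"
  using assms
proof (induction l)
  case (Cons j l)
  show ?case
  proof (cases "j = i")
    case True
    then have "cpow (\<epsilon>(i := 1 - \<epsilon> i)) l = cpow \<epsilon> l"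
      using Cons.prems by (intro cpow_cong) auto
    then have "c i * cpow \<epsilon> (j # l)
        = scl (if \<epsilon> i = 0 then 1 else - 1) (cpow (\<epsilon>(i := 1 - \<epsilon> i)) (j # l))"
      using True Cons.prems c_c_cancel[of i] by (auto simp: cpow_simps)
    then show ?thesis ..
  next
    case False
    then have "\<exists>t. c i * cpow \<epsilon> l = scl t (cpow (\<epsilon>(i := 1 - \<epsilon> i)) l)"
      using Cons.prems by (intro Cons.IH) auto
    then obtain t where t: "c i * cpow \<epsilon> l = scl t (cpow (\<epsilon>(i := 1 - \<epsilon> i)) l)" ..
    have ij: "i \<in> {1..n}" "j \<in> {1..n}" using Cons.prems by auto
    have anticommute: "c i * (c j * y) = - (c j * (c i * y))" for y
      using c_c[OF ij] False by (metis mult.assoc mult_minus_left)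
    have swap: "c i * (c j ^ e * x) = (- 1) ^ e * (c j ^ e * (c i * x))" for e x
    proof (induction e)
      case (Suc e)
      have "c i * (c j ^ Suc e * x) = - (c j * (c i * (c j ^ e * x)))"
        by (simp add: mult.assoc anticommute)
      then show ?case
        unfolding Suc by (simp add: mult.assoc neg_one_power_mult_left)
    qed simp
    have "c i * cpow \<epsilon> (j # l) = scl ((- 1) ^ \<epsilon> j * t) (cpow (\<epsilon>(i := 1 - \<epsilon> i)) (j # l))"
      using False by (cases "even (\<epsilon> j)") (simp_all add: cpow_simps swap t scale_mult_right)
    then show ?thesis ..
  qed
qed simp

text \<open>The span contains \<open>f id\<close>, which is 1, and is stable under left
  multiplication by the generators, hence by all of Seg(W).\<close>

lemma S_span: "S \<subseteq> span {C \<epsilon> * f w | \<epsilon> w. \<epsilon> \<in> {1..n} \<rightarrow>\<^sub>E {0, 1} \<and> w \<in> W}"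
  (is "S \<subseteq> span ?T")
proof -
  have f_in: "f w \<in> span ?T" if "w \<in> W" for w
  proof -
    have "C (\<lambda>i\<in>{1..n}. 0) = cpow (\<lambda>_. 0) [1..<Suc n]"
      by (rule cpow_cong) auto
    also have "\<dots> = 1" unfolding cpow_def by (induction n) (simp_all add: upt_Suc)
    finally have "f w = C (\<lambda>i\<in>{1..n}. 0) * f w" by simp
    then show ?thesis using that by (intro span_base) (force intro!: exI[of _ "\<lambda>i\<in>{1..n}. 0"])
  qed
  have lists: "set [1..<Suc n] = {1..n}" "distinct [1..<Suc n]"
    by auto
  have c_mult: "c i * y \<in> span ?T" if "i \<in> {1..n}" "y \<in> span ?T" for i y
    using that(2)
  proof (induction rule: span_induct_alt)
    case (step t x y)
    obtain \<epsilon> w where x: "x = C \<epsilon> * f w" "\<epsilon> \<in> {1..n} \<rightarrow>\<^sub>E {0, 1}" "w \<in> W"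
      using step(1) by blast
    have "\<exists>t. c i * C \<epsilon> = scl t (C (\<epsilon>(i := 1 - \<epsilon> i)))"
    proof (rule c_mult_cpow)
      show "\<epsilon> i \<in> {0, 1}" using x(2) that(1) by (rule PiE_mem)
    qed (use that(1) in \<open>simp_all only: lists order_refl\<close>)
    then obtain t' where "c i * C \<epsilon> = scl t' (C (\<epsilon>(i := 1 - \<epsilon> i)))" ..
    then have "c i * x = scl t' (C (\<epsilon>(i := 1 - \<epsilon> i)) * f w)"
      by (simp add: x scale_mult_left flip: mult.assoc)
    moreover have "\<epsilon>(i := 1 - \<epsilon> i) \<in> {1..n} \<rightarrow>\<^sub>E {0, 1}"
      using x(2) that(1) by (auto simp: PiE_iff extensional_def)
    then have "C (\<epsilon>(i := 1 - \<epsilon> i)) * f w \<in> ?T" using x(3) by blast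
    ultimately have "c i * x \<in> span ?T"
      by (simp only: span_scale span_base)
    then show ?case
      using step by (simp add: distrib_left scale_mult_right span_add span_scale)
  qed (simp add: span_zero)
  have f_cpow: "f u * (cpow \<epsilon> l * f w) \<in> span ?T"
    if "u \<in> W" "w \<in> W" "set l \<subseteq> {1..n}" for u w \<epsilon> l
    using that(3)
  proof (induction l)
    case Nil
    show ?case using f_in[OF comp_in_W[OF that(1,2)]] f_comp[OF that(1,2)] by (simp add: cpow_simps)
  next
    case (Cons j l)
    have "f u * (c j ^ e * y) \<in> span ?T" if "f u * y \<in> span ?T" for e y
      using that
    proof (induction e)
      case (Suc e)
      have "f u * (c j ^ Suc e * y) = (\<Sum>k=1..n. scl (entry u k j) (c k * (f u * (c j ^ e * y))))"
        using f_mult_c_assoc[OF \<open>u \<in> W\<close>, of j] Cons.prems by (simp add: mult.assoc)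
      then show ?case using c_mult Suc by (auto intro!: span_sum span_scale)
    qed simp
    then show ?case using Cons by (simp add: cpow_simps mult.assoc)
  qed
  have f_mult: "f u * y \<in> span ?T" if "u \<in> W" "y \<in> span ?T" for u y
    using that(2)
  proof (induction rule: span_induct_alt)
    case (step t x y)
    have "f u * x \<in> span ?T"
      using step(1) f_cpow[OF that(1) _ equalityD1[OF lists(1)]] by auto
    then show ?case
      using step by (simp add: distrib_left scale_mult_right span_add span_scale)
  qed (simp add: span_zero)
  have "s * y \<in> span ?T" if "s \<in> S" "y \<in> span ?T" for s y
    using that
    by (induction arbitrary: y rule: S_induct)
      (simp_all add: f_mult c_mult distrib_right scale_mult_left span_add span_scale mult.assoc)
  then have "s * f id \<in> span ?T" if "s \<in> S" for s
    using that f_in id_in_W by blast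
  then show ?thesis by (auto simp: f_id)
qed

definition exponents :: "(nat \<Rightarrow> nat) set" where "exponents = {1..n} \<rightarrow>\<^sub>E UNIV"

lemma exponents_upd [simp]: "k \<in> exponents \<Longrightarrow> i \<in> {1..n} \<Longrightarrow> k(i := m) \<in> exponents"
  unfolding exponents_def by (auto simp: PiE_iff extensional_def)

text \<open>Inserting a letter into an ordered monomial leaves an error of lower degree, which the
  induction on \<open>m\<close> absorbs.\<close>

lemma filt_in_span:
  "filt m x \<Longrightarrow> x \<in> span {A k * s | k s. k \<in> exponents \<and> deg k \<le> m \<and> s \<in> S}"
proof (induction m arbitrary: x)
  have S_in: "s \<in> span {A k * s | k s. k \<in> exponents \<and> deg k \<le> m \<and> s \<in> S}" if "s \<in> S" for s m
  proof -
    have "A (\<lambda>i\<in>{1..n}. 0) = apow (\<lambda>_. 0) [1..<Suc n]"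
      by (rule apow_cong) auto
    also have "\<dots> = 1" unfolding apow_def by (induction n) (simp_all add: upt_Suc)
    finally have "s = A (\<lambda>i\<in>{1..n}. 0) * s" by simp
    then show ?thesis
      using that by (intro span_base) (force intro!: exI[of _ "\<lambda>i\<in>{1..n}. 0"] simp: exponents_def deg_def)
  qed
  {
    case 0
    then show ?case using S_in[of x 0] by (simp add: filt_0_iff)
  next
    case (Suc m)
    let ?B = "\<lambda>m. {A k * s | k s. k \<in> exponents \<and> deg k \<le> m \<and> s \<in> S}"
    have mono: "span (?B m) \<subseteq> span (?B (Suc m))"
      by (rule span_mono) force
    from Suc.prems show ?case
    proof (induction "Suc m" x rule: filt.induct)
      case (filt_a i x)
      have "x \<in> span (?B m)" using Suc.IH filt_a by blast
      then show ?case
      proof (induction rule: span_induct_alt)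
        case (step t b y)
        obtain k s where b: "b = A k * s" "k \<in> exponents" "deg k \<le> m" "s \<in> S"
          using step(1) by blast
        have "A (k(i := Suc (k i))) * s \<in> span (?B (Suc m))"
          using b filt_a(1) deg_upd[of i k "Suc (k i)"] by (intro span_base) force
        \<comment> \<open>The reordering error has degree at most \<open>m\<close>, so the outer
          induction hypothesis applies to it.\<close>
        moreover have "filt m ((a i * A k - A (k(i := Suc (k i)))) * s)"
          using filt_mono[OF filt_mult_S[OF filt_a_mult_A]] b filt_a(1) by blast
        then have "(a i * A k - A (k(i := Suc (k i)))) * s \<in> span (?B (Suc m))"
          using Suc.IH mono by blast
        moreover have "a i * b = A (k(i := Suc (k i))) * s + (a i * A k - A (k(i := Suc (k i)))) * s"
          by (simp add: b algebra_simps)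
        ultimately have "a i * b \<in> span (?B (Suc m))"
          by (simp add: span_add del: left_diff_distrib)
        then show ?case
          using step by (simp add: distrib_left scale_mult_right span_add span_scale)
      qed (simp add: span_zero)
    qed (use S_in in \<open>auto intro: span_add\<close>)
  }
qed

lemma filt_induct [consumes 1, case_names zero step]:
  assumes "filt m x" and "Q 0"
    and "\<And>t k s y. k \<in> exponents \<Longrightarrow> deg k \<le> m \<Longrightarrow> s \<in> S \<Longrightarrow> Q y \<Longrightarrow> Q (scl t (A k * s) + y)"
  shows "Q x"
  using filt_in_span[OF assms(1)]
  by (induction rule: span_induct_alt) (use assms(2,3) in blast)+

section \<open>The leading term of \<open>d\<close>\<close>

text \<open>Crossing \<open>A k\<close> gives \<open>c i\<close> the sign (-1)^(\<open>k i\<close>).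
  The two terms of the commutator with \<open>a i * c i\<close> therefore cancel to leading order if
  \<open>k i\<close> is even and add up if it is odd.\<close>

lemma d_A_mod_filt:
  assumes "s \<in> S"
  shows "filt (deg k) (d (A k * s) -
    (\<Sum>i=1..n. if odd (k i) then scl (- 2) (A (k(i := Suc (k i))) * (c i * s)) else 0))"
proof -
  define k' where "k' i = k(i := Suc (k i))" for i
  \<comment> \<open>Monomials in the \<open>a i\<close> are even, so \<open>d\<close> acts on them
    as the ordinary commutator with \<open>D\<close>.\<close>
  have "parity (apow k l) = apow k l" if "set l \<subseteq> {1..n}" for l
  proof -
    have power: "parity (a i ^ m) = a i ^ m" if "i \<in> {1..n}" for i m
      using that by (induction m) (simp_all add: parity_mult parity_even one_even a_even)
    show ?thesis using that
      by (induction l) (simp_all add: apow_simps parity_mult power parity_even one_even)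
  qed
  moreover have "set [1..<Suc n] \<subseteq> {1..n}" by auto
  ultimately have "d (A k) = D * A k - A k * D"
    unfolding dirac_d_eq by metis
  also have "\<dots> = (\<Sum>i=1..n. a i * (c i * A k) - A k * (a i * c i))"
    by (simp add: dirac_def sum_distrib_left sum_distrib_right mult.assoc sum_subtractf)
  also have "\<dots> = (\<Sum>i=1..n. ((- 1) ^ k i * (a i * A k) - A k * a i) * c i)"
    by (intro sum.cong refl) (simp add: c_mult_A neg_one_power_mult_left left_diff_distrib mult.assoc)
  finally have "d (A k * s) = (\<Sum>i=1..n. ((- 1) ^ k i * (a i * A k) - A k * a i) * (c i * s))"
    using assms by (simp add: d_mult_S sum_distrib_right mult.assoc)
  moreover have "filt (deg k) (((- 1) ^ k i * (a i * A k) - A k * a i) * (c i * s)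
      - (if odd (k i) then scl (- 2) (A (k' i) * (c i * s)) else 0))" if "i \<in> {1..n}" for i
  proof -
    \<comment> \<open>Both products share the leading monomial \<open>A (k' i)\<close>.\<close>
    have lr: "filt (deg k) (a i * A k - A (k' i))" "filt (deg k) (A k * a i - A (k' i))"
      unfolding k'_def using that by (rule filt_a_mult_A filt_A_mult_a)+
    have "filt (deg k) ((if odd (k i) then - (a i * A k - A (k' i)) - (A k * a i - A (k' i))
        else a i * A k - A (k' i) - (A k * a i - A (k' i))) * (c i * s))"
    proof (rule filt_mult_S)
      show "filt (deg k) (if odd (k i) then - (a i * A k - A (k' i)) - (A k * a i - A (k' i))
          else a i * A k - A (k' i) - (A k * a i - A (k' i)))"
        using filt_diff[OF filt_minus[OF lr(1)] lr(2)] filt_diff[OF lr] by simp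
    qed (use that assms in simp)
    also have "(if odd (k i) then - (a i * A k - A (k' i)) - (A k * a i - A (k' i))
        else a i * A k - A (k' i) - (A k * a i - A (k' i))) * (c i * s)
      = ((- 1) ^ k i * (a i * A k) - A k * a i) * (c i * s)
        - (if odd (k i) then scl (- 2) (A (k' i) * (c i * s)) else 0)"
    proof (cases "odd (k i)")
      case True
      have "scl (- 2) x = - x - x" for x
        using scale_left_distrib[of "-1" "-1" x] by simp
      then show ?thesis using True
        by (simp only: if_True power_minus_odd) (simp add: algebra_simps scale_mult_left)
    qed (simp add: algebra_simps)
    finally show ?thesis .
  qed
  ultimately show ?thesis
    unfolding k'_def by (auto simp flip: sum_subtractf intro!: filt_sum)
qed

text \<open>Acting on the first variable that occurs, rather than on all of them, makes the homotopy
  contracting without dividing by the number of variables.\<close>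

definition first_var :: "(nat \<Rightarrow> nat) \<Rightarrow> nat" where
  "first_var k = (LEAST i. i \<in> {1..n} \<and> k i \<noteq> 0)"

lemma first_var_eqI:
  assumes "i \<in> {1..n}" "k i \<noteq> 0" "\<And>j. j \<in> {1..n} \<Longrightarrow> j < i \<Longrightarrow> k j = 0"
  shows "first_var k = i"
  unfolding first_var_def by (rule Least_equality) (use assms in \<open>metis not_le_imp_less\<close>)+

lemma first_var:
  assumes "deg k \<noteq> 0"
  shows "first_var k \<in> {1..n}" "k (first_var k) \<noteq> 0"
    "j \<in> {1..n} \<Longrightarrow> j < first_var k \<Longrightarrow> k j = 0"
proof -
  have "\<exists>i. i \<in> {1..n} \<and> k i \<noteq> 0"
    using assms unfolding deg_def by (metis sum.neutral)
  from LeastI_ex[OF this] show "first_var k \<in> {1..n}" "k (first_var k) \<noteq> 0"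
    unfolding first_var_def by auto
  show "k j = 0" if "j \<in> {1..n}" "j < first_var k"
    using not_less_Least[OF that(2)[unfolded first_var_def]] that(1) by blast
qed

text \<open>Inverts the leading term of \<open>d\<close> in the first variable: it lowers a positive
  even exponent and inserts \<open>c i\<close>. The factor 1/2 is right because (1/2)(-2) times the
  square of \<open>c i\<close> is 1.\<close>

definition homotopy_val :: "(nat \<Rightarrow> nat) \<Rightarrow> 'h \<Rightarrow> 'h" where
  "homotopy_val k s =
    (if deg k = 0 \<or> odd (k (first_var k)) then 0
     else scl (1/2) (A (k(first_var k := k (first_var k) - 1)) * (c (first_var k) * s)))"

text \<open>The values are prescribed on the monomial basis, where \<open>pbw_inj\<close> recovers
  the index, and extended linearly. Both sides are linear in \<open>s\<close>, so
  \<open>S_span\<close> gives the formula for every \<open>s\<close> in Seg(W).\<close>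

lemma homotopy_exists:
  "\<exists>K. is_linear K \<and> (\<forall>k\<in>exponents. \<forall>s\<in>S. K (A k * s) = homotopy_val k s)"
proof -
  let ?p = "pbw_monomial n f c a"
  define g where "g x = (case inv_into (pbw_index n W) ?p x of (k, \<epsilon>, w) \<Rightarrow> homotopy_val k (C \<epsilon> * f w))" for x
  interpret vector_space_pair scl scl by unfold_locales
  obtain K where K: "is_linear K" "\<And>x. x \<in> ?p ` pbw_index n W \<Longrightarrow> K x = g x"
    using linear_independent_extend[OF pbw_independent, of g] by blast
  interpret K: Vector_Spaces.linear scl scl K by (rule K(1))
  have val_linear: "homotopy_val k (s + s') = homotopy_val k s + homotopy_val k s'"
    "homotopy_val k (scl t s) = scl t (homotopy_val k s)" "homotopy_val k 0 = 0" for k t s s'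
    by (simp_all add: homotopy_val_def scale_mult_right distrib_left scale_right_distrib mult.commute)
  have "K (A k * s) = homotopy_val k s" if k: "k \<in> exponents" and "s \<in> S" for k s
  proof -
    have "s \<in> span {C \<epsilon> * f w | \<epsilon> w. \<epsilon> \<in> {1..n} \<rightarrow>\<^sub>E {0, 1} \<and> w \<in> W}"
      using \<open>s \<in> S\<close> S_span by blast
    then show ?thesis
    proof (induction rule: span_induct_alt)
      case (step t x y)
      obtain \<epsilon> w where x: "x = C \<epsilon> * f w" "\<epsilon> \<in> {1..n} \<rightarrow>\<^sub>E {0, 1}" "w \<in> W"
      using step(1) by blast
      have idx: "(k, \<epsilon>, w) \<in> pbw_index n W"
        using k x by (simp add: pbw_index_def exponents_def)
      have p: "?p (k, \<epsilon>, w) = A k * x"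
        by (simp add: pbw_monomial_def apow_def cpow_def x mult.assoc)
      have "K (A k * x) = homotopy_val k x"
        using K(2)[OF imageI[OF idx]] inv_into_f_f[OF pbw_inj idx]
        unfolding g_def p by (simp add: x(1))
      then show ?case
        using step by (simp add: distrib_left scale_mult_right K.add K.scale val_linear)
    qed (simp add: val_linear)
  qed
  then show ?thesis using K(1) by blast
qed

definition homotopy :: "'h \<Rightarrow> 'h" where
  "homotopy = (SOME K. is_linear K \<and> (\<forall>k\<in>exponents. \<forall>s\<in>S. K (A k * s) = homotopy_val k s))"

lemma linear_homotopy: "is_linear homotopy"
  and homotopy_A: "k \<in> exponents \<Longrightarrow> s \<in> S \<Longrightarrow> homotopy (A k * s) = homotopy_val k s"
  using someI_ex[OF homotopy_exists] unfolding homotopy_def[symmetric] by auto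

lemma homotopy_linear_simps:
  "homotopy (x + y) = homotopy x + homotopy y" "homotopy (x - y) = homotopy x - homotopy y"
  "homotopy (scl t x) = scl t (homotopy x)" "homotopy 0 = 0"
  "homotopy (sum g I) = (\<Sum>i\<in>I. homotopy (g i))"
proof -
  interpret K: Vector_Spaces.linear scl scl homotopy by (rule linear_homotopy)
  show "homotopy (x + y) = homotopy x + homotopy y" "homotopy (x - y) = homotopy x - homotopy y"
    "homotopy (scl t x) = scl t (homotopy x)" "homotopy 0 = 0"
    "homotopy (sum g I) = (\<Sum>i\<in>I. homotopy (g i))"
    by (rule K.add K.diff K.scale K.zero K.sum)+
qed

text \<open>The truncation at \<open>m = 0\<close> is harmless: then \<open>deg k = 0\<close> and
  the value is 0.\<close>

lemma filt_homotopy_val: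
  assumes "s \<in> S" "deg k \<le> m"
  shows "filt (m - 1) (homotopy_val k s)"
proof (cases "deg k = 0")
  case False
  define i where "i = first_var k"
  have i: "i \<in> {1..n}" "k i \<noteq> 0" using first_var[OF False] by (auto simp: i_def)
  then have "deg (k(i := k i - 1)) \<le> m - 1"
    using deg_upd[OF i(1), of k "k i - 1"] assms(2) by simp
  then have "filt (m - 1) (A (k(i := k i - 1)) * (c i * s))"
    using i assms by (intro filt_mult_S filt_mono[OF filt_A]) simp_all
  then show ?thesis by (simp add: homotopy_val_def i_def filt_scale filt_0)
qed (simp add: homotopy_val_def filt_0)

lemma filt_homotopy: "filt m x \<Longrightarrow> filt (m - 1) (homotopy x)"
  by (induction rule: filt_induct)
    (auto intro!: filt_add filt_scale filt_0 filt_homotopy_val simp: homotopy_linear_simps homotopy_A)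

text \<open>Let \<open>i\<close> be the first variable. Contributions of another variable
  \<open>j\<close> to the two composites cancel because \<open>c i\<close> and \<open>c j\<close>
  anticommute. For \<open>j = i\<close> exactly one composite contributes, depending on the parity
  of \<open>k i\<close>, and it gives back \<open>A k * s\<close>.\<close>

lemma homotopy_d_A:
  assumes k: "k \<in> exponents" "deg k = Suc m" and s: "s \<in> S"
  shows "filt m (A k * s - d (homotopy (A k * s)) - homotopy (d (A k * s)))"
proof -
  define i where "i = first_var k"
  have i: "i \<in> {1..n}" "k i \<noteq> 0" and below: "\<And>j. j \<in> {1..n} \<Longrightarrow> j < i \<Longrightarrow> k j = 0"
    using first_var[of k] k by (auto simp: i_def)
  define k' where "k' = k(i := k i - 1)"
  have deg_k': "deg k' = m" using deg_upd[OF i(1), of k "k i - 1"] i k by (simp add: k'_def)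
  \<comment> \<open>\<open>t j\<close> and \<open>u j\<close> are the leading contributions of the
    variable \<open>j\<close> to \<open>homotopy (d (A k * s))\<close> and to
    \<open>d (homotopy (A k * s))\<close>.\<close>
  define t where "t j = (if odd (k j) then
      scl (- 2) (homotopy_val (k(j := Suc (k j))) (c j * s)) else 0)" for j
  define u where "u j = (if even (k i) \<and> odd (k' j) then
      - (A (k'(j := Suc (k' j))) * (c j * (c i * s))) else 0)" for j
  have "filt (Suc m - 1) (homotopy (d (A k * s) -
    (\<Sum>j=1..n. if odd (k j) then scl (- 2) (A (k(j := Suc (k j))) * (c j * s)) else 0)))"
    using d_A_mod_filt[OF s, of k] k by (intro filt_homotopy) simp
  moreover have "homotopy (\<Sum>j=1..n. if odd (k j) then
      scl (- 2) (A (k(j := Suc (k j))) * (c j * s)) else 0) = (\<Sum>j=1..n. t j)"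
    unfolding homotopy_linear_simps t_def using s k
    by (intro sum.cong refl) (auto simp: homotopy_linear_simps homotopy_A simp del: scale_minus_left atLeastAtMost_iff)
  ultimately have Kd: "filt m (homotopy (d (A k * s)) - (\<Sum>j=1..n. t j))"
    by (simp add: homotopy_linear_simps)
  have dK: "filt m (d (homotopy (A k * s)) - (\<Sum>j=1..n. u j))"
  proof (cases "even (k i)")
    case True
    have "homotopy (A k * s) = scl (1/2) (A k' * (c i * s))"
      using True k s by (simp add: homotopy_A homotopy_val_def k'_def i_def)
    moreover have "scl (1/2) (\<Sum>j=1..n. if odd (k' j) then
        scl (- 2) (A (k'(j := Suc (k' j))) * (c j * (c i * s))) else 0) = (\<Sum>j=1..n. u j)"
      unfolding scale_sum_right u_def using True by (intro sum.cong refl) simp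
    ultimately show ?thesis
      using filt_scale[OF d_A_mod_filt[of "c i * s" k'], of "1/2"] i(1) s
      by (simp add: deg_k' d_scale scale_right_diff_distrib)
  next
    case False
    then show ?thesis using k s
      by (simp add: homotopy_A homotopy_val_def u_def d_0 filt_0 flip: i_def)
  qed
  have "t j + u j = (if j = i then A k * s else 0)" if j: "j \<in> {1..n}" for j
  proof -
    have t: "t j = (if even ((k(j := Suc (k j))) i) then
      - (A ((k(j := Suc (k j)))(i := (k(j := Suc (k j))) i - 1)) * (c i * (c j * s))) else 0)"
      if "odd (k j)"
    proof -
      \<comment> \<open>An odd \<open>k j\<close> is nonzero, so \<open>j\<close> does not precede
        \<open>i\<close>, and raising its exponent leaves the first variable in place.\<close>
      have "first_var (k(j := Suc (k j))) = i"
      proof (rule first_var_eqI)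
        have "\<not> j < i" using below[OF j] that by auto
        then show "l < i \<Longrightarrow> l \<in> {1..n} \<Longrightarrow> (k(j := Suc (k j))) l = 0" for l
          using below by auto
      qed (use i in auto)
      moreover have "deg (k(j := Suc (k j))) \<noteq> 0"
        using deg_upd[OF j, of k "Suc (k j)"] by simp
      ultimately show ?thesis using that by (simp add: t_def homotopy_val_def)
    qed
    show ?thesis
    proof (cases "j = i")
      case True
      have "k'(i := Suc (k' i)) = k" "k(i := k i) = k" using i by (auto simp: k'_def)
      then show ?thesis
        using True t c_c_cancel[OF i(1)] i by (cases "odd (k i)") (simp_all add: u_def t_def k'_def)
    next
      case False
      have "c i * (c j * s) = - (c j * (c i * s))"
        using c_c[OF i(1) j] False by (simp flip: mult.assoc)
      moreover have "(k(j := Suc (k j)))(i := k i - 1) = k'(j := Suc (k' j))"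
        using False by (auto simp: k'_def)
      ultimately show ?thesis
        using False t by (cases "odd (k j)") (simp_all add: u_def t_def k'_def)
    qed
  qed
  then have "(\<Sum>j=1..n. t j) + (\<Sum>j=1..n. u j) = A k * s"
    using i(1) by (simp flip: sum.distrib)
  then have "A k * s - d (homotopy (A k * s)) - homotopy (d (A k * s))
    = - (homotopy (d (A k * s)) - (\<Sum>j=1..n. t j)) - (d (homotopy (A k * s)) - (\<Sum>j=1..n. u j))"
    by (simp add: algebra_simps)
  then show ?thesis using filt_diff[OF filt_minus[OF Kd] dK] by (simp only:)
qed

lemma homotopy_d_mod_filt:
  assumes "filt (Suc m) x"
  shows "filt m (x - d (homotopy x) - homotopy (d x))"
  using assms
proof (induction rule: filt_induct)
  case (step t k s y)
  define b where "b = A k * s"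
  have "filt m (b - d (homotopy b) - homotopy (d b))"
  proof (cases "deg k = 0")
    \<comment> \<open>In degree 0 both homotopy terms vanish; the remainder is \<open>b\<close>
      itself, which already lies in Seg(W).\<close>
    case True
    then have b: "filt 0 b"
      using filt_mult_S[OF filt_A[of k] step(3)] by (simp add: b_def)
    then have "homotopy b = 0" "d b = 0"
      using True step by (simp_all add: b_def homotopy_A homotopy_val_def d_S filt_0_iff)
    then show ?thesis using filt_mono[OF b] by (simp add: d_0 homotopy_linear_simps)
  next
    case False
    then obtain m' where m': "deg k = Suc m'" by (cases "deg k") auto
    then show ?thesis
      using filt_mono[OF homotopy_d_A[OF step(1) m' step(3)], of m] step(2) by (simp add: b_def)
  qed
  then have "filt m (scl t (b - d (homotopy b) - homotopy (d b)) + (y - d (homotopy y) - homotopy (d y)))"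
    using step by (intro filt_add filt_scale)
  then show ?case
    unfolding b_def[symmetric] homotopy_linear_simps d_add d_scale scale_right_diff_distrib
    by (simp only: diff_diff_eq add_diff_add add_ac)
qed (simp add: d_0 homotopy_linear_simps filt_0)

text \<open>In general \<open>d\<close> raises the degree by one. If \<open>d x\<close> stays in
  degree \<open>Suc m\<close>, then \<open>homotopy (d x)\<close> drops to degree \<open>m\<close>,
  and \<open>x\<close> is exact modulo that degree.\<close>

lemma filt_exact_mod:
  assumes "filt (Suc m) x" "filt (Suc m) (d x)"
  shows "filt m (homotopy x)" "filt m (x - d (homotopy x))"
  using filt_homotopy[OF assms(1)] filt_homotopy[OF assms(2)]
    filt_add[OF homotopy_d_mod_filt[OF assms(1)], of "homotopy (d x)"] by auto

subsection \<open>The supercommutant and averaging\<close>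

text \<open>Supercommutation with Seg(W), tested on generators only;
  \<open>supercommute_commutant\<close> recovers the full condition.\<close>

definition commutant :: "'h set" where
  "commutant = {h. (\<forall>w\<in>W. f w * h = h * f w) \<and> (\<forall>i\<in>{1..n}. h * c i = c i * parity h)}"

lemma supercommute_commutant: "h \<in> commutant \<Longrightarrow> s \<in> S \<Longrightarrow> supercommute G h s"
  by (rule supercommute_hull[of "f ` W \<union> c ` {1..n}"])
    (auto simp: commutant_def f_even c_odd Seg_def)

text \<open>The twist by \<open>parity\<close> disappears for even \<open>h\<close>. This links the
  supercommutant with the ordinary centers.\<close>

lemma even_commutant_iff:
  assumes "parity h = h"
  shows "h \<in> commutant \<longleftrightarrow> (\<forall>s\<in>S. h * s = s * h)"
proof
  assume h: "h \<in> commutant"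
  show "\<forall>s\<in>S. h * s = s * h"
  proof
    fix s assume "s \<in> S"
    then show "h * s = s * h"
    proof (induction rule: S_induct)
      case (mult x y)
      then show ?case by (metis mult.assoc)
    qed (use h assms in \<open>auto simp: commutant_def distrib_left distrib_right
        scale_mult_left scale_mult_right\<close>)
  qed
qed (use assms in \<open>auto simp: commutant_def\<close>)

lemma subspace_commutant: "subspace commutant"
  by (rule subspaceI) (auto simp: commutant_def distrib_left distrib_right
      scale_mult_left scale_mult_right parity_add parity_scale)

lemma parity_commutant:
  assumes "h \<in> commutant"
  shows "parity h \<in> commutant"
proof -
  have "parity h * c i = c i * h" if "i \<in> {1..n}" for i
  proof -
    have "parity (h * c i) = parity (c i * parity h)"
      using assms that by (simp add: commutant_def)
    then show ?thesis using that by (simp add: parity_mult parity_odd c_odd)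
  qed
  moreover have "f w * parity h = parity h * f w" if "w \<in> W" for w
  proof -
    have "parity (f w * h) = parity (h * f w)"
      using assms that by (simp add: commutant_def)
    then show ?thesis using that by (simp add: parity_mult parity_even f_even)
  qed
  ultimately show ?thesis by (simp add: commutant_def)
qed

lemma d_commutant:
  assumes "h \<in> commutant"
  shows "d h \<in> commutant"
proof -
  have "d h * c i = c i * parity (d h)" if "i \<in> {1..n}" for i
  proof -
    have "d h * c i = d (c i * parity h)"
      using assms that by (simp add: commutant_def flip: d_mult_S)
    also have "\<dots> = - (c i * d (parity h))"
      using that by (simp add: d_S_mult parity_odd c_odd)
    finally show ?thesis by (simp add: parity_d)
  qed
  moreover have "f w * d h = d h * f w" if "w \<in> W" for w
  proof -
    have "f w * d h = d (f w * h)"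
      using that by (simp add: d_S_mult parity_even f_even)
    also have "\<dots> = d h * f w"
      using assms that by (simp add: commutant_def d_mult_S)
    finally show ?thesis .
  qed
  ultimately show ?thesis by (simp add: commutant_def)
qed

text \<open>Since \<open>D\<close> is odd, the two mixed terms \<open>D * parity h * D\<close>
  cancel and only the commutator with \<open>D ^ 2\<close> remains.\<close>

lemma d_d_commutant:
  assumes "dirac_square_central G S D" "h \<in> commutant"
  shows "d (d h) = 0"
proof -
  have "d (d h) = D ^ 2 * h - h * D ^ 2"
    unfolding dirac_d_eq by (simp add: parity_mult D_odd power2_eq_square algebra_simps)
  then show ?thesis
    using assms supercommute_commutant unfolding dirac_square_central_def by simp
qed

section \<open>Averaging over the \<open>c i\<close> and over \<open>W\<close>\<close>

text \<open>The subspaces preserved by the averaging operators. Besides the filtration steps they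
  include the whole algebra and 0, so that exact solutions can be averaged too.\<close>

definition bimodule :: "'h set \<Rightarrow> bool" where
  "bimodule R \<longleftrightarrow> subspace R \<and> (\<forall>x\<in>R. parity x \<in> R \<and> (\<forall>s\<in>S. s * x \<in> R \<and> x * s \<in> R))"

lemma bimodule_filt: "bimodule {x. filt m x}"
  unfolding bimodule_def using subspace_filt by (auto intro: filt_parity filt_S_mult filt_mult_S)

lemma bimodule_UNIV: "bimodule UNIV" and bimodule_zero: "bimodule {0}"
  unfolding bimodule_def by (auto intro: subspace_UNIV)

text \<open>Conjugation by \<open>c i\<close>, whose inverse is \<open>- c i\<close>, combined with
  the parity. Its fixed points are the elements supercommuting with \<open>c i\<close>.\<close>

definition twist :: "nat \<Rightarrow> 'h \<Rightarrow> 'h" where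
  "twist i x = - (c i * parity x * c i)"

lemma twist_fixed_iff:
  assumes "i \<in> {1..n}"
  shows "twist i x = x \<longleftrightarrow> x * c i = c i * parity x"
proof
  assume "twist i x = x"
  then have "x * c i = - (c i * parity x * c i) * c i" by (simp add: twist_def)
  then show "x * c i = c i * parity x" by (simp add: mult.assoc c_square'[OF assms])
next
  assume "x * c i = c i * parity x"
  then have "twist i x = - (x * c i * c i)" by (simp add: twist_def)
  then show "twist i x = x" by (simp add: mult.assoc c_square'[OF assms])
qed

lemma twist_twist:
  assumes "i \<in> {1..n}"
  shows "twist i (twist i x) = x"
  using assms c_c_cancel[OF assms]
  by (simp add: twist_def parity_mult parity_odd c_odd mult.assoc c_square')

text \<open>Exchanging \<open>c i\<close> and \<open>c j\<close> costs a sign on each side of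
  \<open>x\<close>.\<close>

lemma twist_commute:
  assumes "i \<in> {1..n}" "j \<in> {1..n}"
  shows "twist i (twist j x) = twist j (twist i x)"
proof (cases "i = j")
  case False
  have "twist i (twist j x) = c i * c j * x * (c j * c i)"
    "twist j (twist i x) = c j * c i * x * (c i * c j)"
    using assms by (simp_all add: twist_def parity_mult parity_odd c_odd mult.assoc)
  then show ?thesis using c_c[OF assms False] by simp
qed simp

lemma twist_add: "twist i (x + y) = twist i x + twist i y"
  and twist_diff: "twist i (x - y) = twist i x - twist i y"
  and twist_scale: "twist i (scl t x) = scl t (twist i x)"
  by (simp_all add: twist_def parity_add parity_scale algebra_simps scale_mult_left scale_mult_right)

lemma d_twist:
  assumes "i \<in> {1..n}"
  shows "d (twist i x) = twist i (d x)"
  using assms by (simp add: twist_def d_minus d_mult_S d_S_mult parity_d parity_odd c_odd)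

text \<open>One twist is averaged at a time; as twists commute, the invariance already gained is
  kept. They commute with \<open>d\<close> and fix \<open>y\<close>, so \<open>y - d x\<close> is
  averaged along with \<open>x\<close>.\<close>

lemma average_c:
  assumes y: "y \<in> commutant" and R: "bimodule R" "bimodule R'"
    and x: "x \<in> R" "y - d x \<in> R'" and J: "J \<subseteq> {1..n}"
  shows "\<exists>x'\<in>R. y - d x' \<in> R' \<and> (\<forall>i\<in>J. x' * c i = c i * parity x')"
proof -
  have "finite J" using J finite_subset by blast
  then show ?thesis using J
  proof (induction J rule: finite_induct)
    case empty
    then show ?case using x by blast
  next
    case (insert j J)
    then obtain x' where x': "x' \<in> R" "y - d x' \<in> R'" "\<forall>i\<in>J. x' * c i = c i * parity x'"
      by auto
    have j: "j \<in> {1..n}" and J: "J \<subseteq> {1..n}" using insert.prems by auto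
    define x'' where "x'' = scl (1/2) (x' + twist j x')"
    have twist_in: "twist j r \<in> R''" if "r \<in> R''" "bimodule R''" for r R''
      using that j unfolding bimodule_def twist_def by (auto intro!: subspace_neg)
    have "twist j y = y"
      using y j twist_fixed_iff[OF j] by (simp add: commutant_def)
    then have "y = scl (1/2) (y + twist j y)" by (simp add: scale_half_double)
    then have "y - d x'' = scl (1/2) (y + twist j y) - scl (1/2) (d x' + twist j (d x'))"
      by (simp add: x''_def d_scale d_add d_twist[OF j])
    also have "\<dots> = scl (1/2) ((y - d x') + twist j (y - d x'))"
      by (simp only: twist_diff add_diff_add flip: scale_right_diff_distrib)
    finally have "y - d x'' \<in> R'"
      using x'(2) R(2) twist_in unfolding bimodule_def by (auto intro!: subspace_scale subspace_add)
    moreover have "x'' \<in> R"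
      unfolding x''_def using x'(1) R(1) twist_in unfolding bimodule_def
      by (auto intro!: subspace_scale subspace_add)
    moreover have "twist i x'' = x''" if "i \<in> insert j J" for i
    proof (cases "i = j")
      case True
      then show ?thesis
        by (simp add: x''_def twist_add twist_scale twist_twist[OF j] add.commute)
    next
      case False
      then have "i \<in> J" "i \<in> {1..n}" using that J by auto
      then show ?thesis
        using x'(3) twist_fixed_iff[of i x']
        by (simp add: x''_def twist_add twist_scale twist_commute[OF _ j])
    qed
    ultimately show ?case
      using twist_fixed_iff j J by (metis insert_iff subsetD)
  qed
qed

definition conjugate :: "('e \<Rightarrow> 'e) \<Rightarrow> 'h \<Rightarrow> 'h" where
  "conjugate w x = f w * x * f (inv_into UNIV w)"

lemma conjugate_comp:
  assumes "u \<in> W" "w \<in> W"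
  shows "conjugate u (conjugate w x) = conjugate (u \<circ> w) x"
proof -
  have "inv_into UNIV (u \<circ> w) = inv_into UNIV w \<circ> inv_into UNIV u"
    using assms bij_W by (simp add: o_inv_distrib)
  then show ?thesis
    using assms inv_in_W by (simp add: conjugate_def f_comp mult.assoc)
qed

lemma conjugate_fixed_iff:
  assumes "w \<in> W"
  shows "conjugate w x = x \<longleftrightarrow> f w * x = x * f w"
proof
  assume "conjugate w x = x"
  then have "x * f w = conjugate w x * f w" by simp
  then show "f w * x = x * f w" by (simp add: conjugate_def mult.assoc f_inv[OF assms])
next
  assume "f w * x = x * f w"
  then show "conjugate w x = x" by (simp add: conjugate_def mult.assoc f_inv[OF assms])
qed

lemma d_conjugate:
  assumes "w \<in> W"
  shows "d (conjugate w x) = conjugate w (d x)"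
  using assms inv_in_W by (simp add: conjugate_def d_mult_S d_S_mult parity_even f_even)

text \<open>Guarantees that averaging over \<open>W\<close> preserves supercommutation with the
  \<open>c i\<close>: conjugation by group elements maps their span into itself.\<close>

lemma conjugate_supercommutes_c:
  assumes x: "\<And>i. i \<in> {1..n} \<Longrightarrow> x * c i = c i * parity x" and w: "w \<in> W" and i: "i \<in> {1..n}"
  shows "conjugate w x * c i = c i * parity (conjugate w x)"
proof -
  define e where "e = f (inv_into UNIV w) * c i * f w"
  \<comment> \<open>\<open>e\<close> is a linear combination of the \<open>c j\<close>, so
    \<open>x\<close> supercommutes with it.\<close>
  have xe: "x * e = e * parity x"
    unfolding e_def conj_inv_c[OF w i]
    by (simp only: sum_distrib_left sum_distrib_right scale_mult_left scale_mult_right)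
      (intro sum.cong refl, simp only: x)
  have e: "f (inv_into UNIV w) * c i = e * f (inv_into UNIV w)" "f w * e = c i * f w"
    by (simp_all add: e_def mult.assoc f_inv[OF w] f_inv_cancel[OF w])
  have "conjugate w x * c i = f w * (x * e) * f (inv_into UNIV w)"
    by (simp only: conjugate_def mult.assoc e(1))
  also have "\<dots> = f w * e * parity x * f (inv_into UNIV w)"
    by (simp only: xe mult.assoc)
  also have "\<dots> = c i * parity (conjugate w x)"
    using w inv_in_W e(2)
    by (simp add: conjugate_def parity_mult parity_even f_even mult.assoc)
  finally show ?thesis .
qed

text \<open>The \<open>c i\<close> are treated first, then \<open>W\<close>, whose averaging does
  not destroy the first invariance. As before, conjugation fixes \<open>y\<close> and commutes with
  \<open>d\<close>.\<close>

lemma average: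
  assumes y: "y \<in> commutant" and R: "bimodule R" "bimodule R'"
    and x: "x \<in> R" "y - d x \<in> R'"
  shows "\<exists>x'\<in>R \<inter> commutant. y - d x' \<in> R'"
proof -
  obtain x1 where x1: "x1 \<in> R" "y - d x1 \<in> R'"
    and c: "\<And>i. i \<in> {1..n} \<Longrightarrow> x1 * c i = c i * parity x1"
    using average_c[OF assms order_refl] by blast
  define x' where "x' = scl (1 / of_nat (card W)) (\<Sum>w\<in>W. conjugate w x1)"
  have card: "card W \<noteq> 0" using finite_W id_in_W by auto
  have conjugate_in: "conjugate w r \<in> R''" if "w \<in> W" "r \<in> R''" "bimodule R''" for w r R''
    using that inv_in_W unfolding conjugate_def bimodule_def by auto
  have average_const: "scl (1 / of_nat (card W)) (\<Sum>w\<in>W. z) = z" for z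
  proof -
    have "(\<Sum>w\<in>W. z) = scl (of_nat (card W)) z"
      using scale_sum_left[of "\<lambda>_. 1" W z] by simp
    then show ?thesis using card by simp
  qed
  have "(\<Sum>w\<in>W. conjugate w y) = (\<Sum>w\<in>W. y)"
    using y conjugate_fixed_iff by (intro sum.cong) (simp_all add: commutant_def)
  then have "y = scl (1 / of_nat (card W)) (\<Sum>w\<in>W. conjugate w y)"
    by (simp only: average_const)
  then have "y - d x' = scl (1 / of_nat (card W)) (\<Sum>w\<in>W. conjugate w y)
      - scl (1 / of_nat (card W)) (\<Sum>w\<in>W. conjugate w (d x1))"
    by (simp add: x'_def d_scale d_sum d_conjugate)
  also have "\<dots> = scl (1 / of_nat (card W)) (\<Sum>w\<in>W. conjugate w (y - d x1))"
    by (simp add: conjugate_def algebra_simps flip: scale_right_diff_distrib sum_subtractf)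
  finally have "y - d x' \<in> R'"
    using x1(2) R(2) conjugate_in unfolding bimodule_def
    by (auto intro!: subspace_scale subspace_sum)
  moreover have "x' \<in> R"
    unfolding x'_def using x1(1) R(1) conjugate_in unfolding bimodule_def
    by (auto intro!: subspace_scale subspace_sum)
  moreover have "x' \<in> commutant"
  proof -
    have "conjugate u x' = x'" if "u \<in> W" for u
    proof -
      have "conjugate u x' = scl (1 / of_nat (card W)) (\<Sum>w\<in>W. conjugate (u \<circ> w) x1)"
        using that by (simp add: x'_def conjugate_def[of u] scale_mult_right scale_mult_left
            sum_distrib_left sum_distrib_right flip: conjugate_comp)
      also have "(\<Sum>w\<in>W. conjugate (u \<circ> w) x1) = (\<Sum>w\<in>W. conjugate w x1)"
        by (rule sum.reindex_bij_witness[of _ "\<lambda>w. inv_into UNIV u \<circ> w" "\<lambda>w. u \<circ> w"])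
          (use that bij_W[OF that] in \<open>auto simp: comp_in_W inv_in_W fun_eq_iff bij_is_inj
              bij_is_surj surj_f_inv_f\<close>)
      finally show ?thesis by (simp add: x'_def)
    qed
    moreover have "x' * c i = c i * parity x'" if "i \<in> {1..n}" for i
      using conjugate_supercommutes_c[OF c] that
      by (simp add: x'_def scale_mult_left scale_mult_right parity_scale sum_distrib_left
          sum_distrib_right cong: sum.cong)
    ultimately show ?thesis using conjugate_fixed_iff by (simp add: commutant_def)
  qed
  ultimately show ?thesis by blast
qed

section \<open>Descent in the filtration and the map \<open>zeta\<close>\<close>

text \<open>An averaged primitive \<open>x'\<close> removes the top degree of \<open>y\<close>.
  Because \<open>d (d x') = 0\<close> on the supercommutant, \<open>y - d x'\<close> satisfies the
  same hypotheses in lower degree.\<close>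

lemma commutant_exact_mod_S:
  assumes central: "dirac_square_central G S D"
    and "filt m y" "y \<in> commutant" "d y \<in> S"
  shows "\<exists>x\<in>commutant. y - d x \<in> S"
  using assms(2-)
proof (induction m arbitrary: y)
  case 0
  then show ?case
    using subspace_0[OF subspace_commutant] by (intro bexI[of _ 0]) (simp_all add: filt_0_iff d_0)
next
  case (Suc m)
  have "filt (Suc m) (d y)" using Suc.prems(3) by (rule filt_S)
  then have "homotopy y \<in> {x. filt m x}" "y - d (homotopy y) \<in> {x. filt m x}"
    using filt_exact_mod[OF Suc.prems(1)] by auto
  from average[OF Suc.prems(2) bimodule_filt bimodule_filt this]
  obtain x' where x': "x' \<in> commutant" "filt m (y - d x')" by auto
  have "y - d x' \<in> commutant"
    using Suc.prems(2) x'(1) by (intro subspace_diff[OF subspace_commutant] d_commutant)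
  moreover have "d (y - d x') \<in> S"
    using Suc.prems(3) d_d_commutant[OF central x'(1)] by (simp add: d_diff)
  ultimately obtain x'' where x'': "x'' \<in> commutant" "y - d x' - d x'' \<in> S"
    using Suc.IH[OF x'(2)] by blast
  then have "x' + x'' \<in> commutant" "y - d (x' + x'') \<in> S"
    using x'(1) subspace_add[OF subspace_commutant] by (simp_all add: d_add diff_diff_eq)
  then show ?case by blast
qed

text \<open>Averaging with error space 0 makes the primitive supercommute with Seg(W) while keeping
  \<open>s = d y'\<close> exact. By descent \<open>y'\<close> is then \<open>d x\<close> plus an
  element of Seg(W), and \<open>d\<close> kills both.\<close>

lemma exact_in_S_eq_zero:
  assumes central: "dirac_square_central G S D"
    and "s \<in> S" "s \<in> commutant" "s = d y"
  shows "s = 0"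
proof -
  obtain y' where y': "y' \<in> commutant" "s = d y'"
    using average[OF assms(3) bimodule_UNIV bimodule_zero, of y] assms(4) by auto
  obtain m where "filt m y'" using filt_exhaust by blast
  from commutant_exact_mod_S[OF central this y'(1)] obtain x
    where x: "x \<in> commutant" "y' - d x \<in> S" using assms(2) y'(2) by auto
  have "d y' = d (y' - d x)" using d_d_commutant[OF central x(1)] by (simp add: d_diff)
  then show ?thesis using d_S[OF x(2)] y'(2) by simp
qed

lemma even_center_S_iff: "s \<in> even_center G S \<longleftrightarrow> s \<in> S \<and> parity s = s \<and> s \<in> commutant"
  using even_commutant_iff[of s] by (auto simp: even_center_def even_iff_parity)

lemma zeta_unique_exists:
  assumes central: "dirac_square_central G S D" and z: "z \<in> even_center G UNIV"
  shows "\<exists>!s. s \<in> even_center G S \<and> z - s \<in> range d"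
proof (rule ex_ex1I)
  have z_even: "parity z = z" and z_comm: "z * h = h * z" for h
    using z by (auto simp: even_center_def even_iff_parity)
  then have "z \<in> commutant" "d z = 0"
    by (simp_all add: commutant_def dirac_d_eq)
  moreover obtain m where "filt m z" using filt_exhaust by blast
  ultimately obtain x where x: "x \<in> commutant" and s': "z - d x \<in> S"
    using commutant_exact_mod_S[OF central] by (metis S_closed(1))
  \<comment> \<open>The even part of \<open>z - d x\<close>. Passing to it keeps the difference from
    \<open>z\<close> exact because \<open>parity\<close> anticommutes with \<open>d\<close>.\<close>
  define s where "s = scl (1/2) ((z - d x) + parity (z - d x))"
  have "z - d x \<in> commutant"
    using \<open>z \<in> commutant\<close> x by (intro subspace_diff[OF subspace_commutant] d_commutant)
  then have "s \<in> commutant"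
    unfolding s_def by (intro subspace_scale subspace_add subspace_commutant parity_commutant)
  moreover have "s \<in> S"
    unfolding s_def using s' by (intro S_closed(3,4) parity_in_S)
  moreover have "parity s = s"
    by (simp only: s_def parity_scale parity_add parity_parity add.commute)
  ultimately have "s \<in> even_center G S" by (simp only: even_center_S_iff)
  moreover have "z - s = d (scl (1/2) (x - parity x))"
  proof -
    have "s = scl (1/2) ((z + z) - d (x - parity x))"
      unfolding s_def by (simp add: z_even parity_d d_diff)
    then show ?thesis
      by (simp add: scale_right_diff_distrib scale_half_double d_scale d_diff del: scale_right_distrib)
  qed
  ultimately show "\<exists>s. s \<in> even_center G S \<and> z - s \<in> range d" by blast
next
  fix s s' assume s: "s \<in> even_center G S \<and> z - s \<in> range d"
    and s': "s' \<in> even_center G S \<and> z - s' \<in> range d"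
  then obtain y y' where "z - s = d y" "z - s' = d y'" by blast
  \<comment> \<open>Two candidates differ by an exact element of Seg(W) in the supercommutant, which
    must vanish.\<close>
  then have "s - s' = d (y' - y)" by (simp add: d_diff flip: \<open>z - s = d y\<close> \<open>z - s' = d y'\<close>)
  moreover have "s - s' \<in> S" "s - s' \<in> commutant"
    using s s' subspace_diff[OF subspace_commutant] by (auto simp: even_center_S_iff)
  ultimately show "s = s'"
    using exact_in_S_eq_zero[OF central] by fastforce
qed

lemma zeta:
  assumes "dirac_square_central G S D" "z \<in> even_center G UNIV"
  shows "zeta G S D z \<in> even_center G S" "\<exists>y. z - zeta G S D z = d y"
  using theI'[OF zeta_unique_exists[OF assms]] unfolding zeta_def by auto

end

section \<open>Dirac cohomology\<close>

lemma left_moduleD: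
  assumes "left_module R M"
  shows "abelian_group M"
    and "r \<in> R \<Longrightarrow> x \<in> carrier M \<Longrightarrow> r \<odot>\<^bsub>M\<^esub> x \<in> carrier M"
    and "r \<in> R \<Longrightarrow> s \<in> R \<Longrightarrow> x \<in> carrier M \<Longrightarrow>
      (r + s) \<odot>\<^bsub>M\<^esub> x = r \<odot>\<^bsub>M\<^esub> x \<oplus>\<^bsub>M\<^esub> s \<odot>\<^bsub>M\<^esub> x"
    and "r \<in> R \<Longrightarrow> x \<in> carrier M \<Longrightarrow> y \<in> carrier M \<Longrightarrow>
      r \<odot>\<^bsub>M\<^esub> (x \<oplus>\<^bsub>M\<^esub> y) = r \<odot>\<^bsub>M\<^esub> x \<oplus>\<^bsub>M\<^esub> r \<odot>\<^bsub>M\<^esub> y"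
    and "r \<in> R \<Longrightarrow> s \<in> R \<Longrightarrow> x \<in> carrier M \<Longrightarrow> (r * s) \<odot>\<^bsub>M\<^esub> x = r \<odot>\<^bsub>M\<^esub> (s \<odot>\<^bsub>M\<^esub> x)"
    and "x \<in> carrier M \<Longrightarrow> 1 \<odot>\<^bsub>M\<^esub> x = x"
  using assms unfolding left_module_def by blast+

lemma left_module_smult_zero:
  assumes "left_module R M" "r \<in> R"
  shows "r \<odot>\<^bsub>M\<^esub> \<zero>\<^bsub>M\<^esub> = \<zero>\<^bsub>M\<^esub>"
proof -
  interpret M: abelian_group M by (rule left_moduleD(1)[OF assms(1)])
  have "r \<odot>\<^bsub>M\<^esub> \<zero>\<^bsub>M\<^esub> \<oplus>\<^bsub>M\<^esub> r \<odot>\<^bsub>M\<^esub> \<zero>\<^bsub>M\<^esub> = r \<odot>\<^bsub>M\<^esub> \<zero>\<^bsub>M\<^esub>"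
    using left_moduleD(4)[OF assms(1,2) M.zero_closed M.zero_closed] by simp
  then show ?thesis
    using left_moduleD(2)[OF assms(1,2) M.zero_closed] M.add.r_cancel_one' by metis
qed

lemma left_module_zero_smult:
  assumes "left_module R M" "(0 :: 'h :: ring_1) \<in> R" "x \<in> carrier M"
  shows "0 \<odot>\<^bsub>M\<^esub> x = \<zero>\<^bsub>M\<^esub>"
proof -
  interpret M: abelian_group M by (rule left_moduleD(1)[OF assms(1)])
  have "0 \<odot>\<^bsub>M\<^esub> x \<oplus>\<^bsub>M\<^esub> 0 \<odot>\<^bsub>M\<^esub> x = 0 \<odot>\<^bsub>M\<^esub> x"
    using left_moduleD(3)[OF assms(1,2,2,3)] by simp
  then show ?thesis
    using left_moduleD(2)[OF assms] M.add.r_cancel_one' by metis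
qed

text \<open>Isolates what the action on cohomology requires of Seg(W). The first identity in
  \<open>twisted\<close> makes the kernel of \<open>D\<close> stable, the second its image.\<close>

locale dirac_module =
  fixes X :: "('h::ring_1, 'x) module" and D :: 'h and S :: "'h set" and p :: "'h \<Rightarrow> 'h"
  assumes X: "left_module UNIV X"
    and S_ring: "1 \<in> S" "\<And>s t. s \<in> S \<Longrightarrow> t \<in> S \<Longrightarrow> s + t \<in> S" "\<And>s t. s \<in> S \<Longrightarrow> t \<in> S \<Longrightarrow> s * t \<in> S"
    and twisted: "s \<in> S \<Longrightarrow> D * s = p s * D" "s \<in> S \<Longrightarrow> D * p s = s * D"
begin

abbreviation "act \<equiv> (\<lambda>h x. h \<odot>\<^bsub>X\<^esub> x)"
abbreviation "H \<equiv> dirac_cohomology X D"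
abbreviation "K \<equiv> dirac_ker X D"
abbreviation "N \<equiv> dirac_ker X D \<inter> dirac_im X D"
abbreviation "cls \<equiv> dirac_class X D"

sublocale X: abelian_group X by (rule left_moduleD(1)[OF X])

lemmas act_closed [simp] = left_moduleD(2)[OF X UNIV_I]
  and act_add_left = left_moduleD(3)[OF X UNIV_I UNIV_I]
  and act_add = left_moduleD(4)[OF X UNIV_I]
  and act_mult = left_moduleD(5)[OF X UNIV_I UNIV_I]
  and act_one [simp] = left_moduleD(6)[OF X]
  and act_zero [simp] = left_module_smult_zero[OF X UNIV_I]
  and zero_act [simp] = left_module_zero_smult[OF X UNIV_I]

lemma act_minus:
  assumes "x \<in> carrier X"
  shows "act h (\<ominus>\<^bsub>X\<^esub> x) = \<ominus>\<^bsub>X\<^esub> (act h x)"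
proof -
  have "act h (\<ominus>\<^bsub>X\<^esub> x) \<oplus>\<^bsub>X\<^esub> act h x = \<zero>\<^bsub>X\<^esub>"
    using assms by (simp add: X.l_neg flip: act_add)
  then show ?thesis using assms by (intro X.minus_equality[symmetric]) simp_all
qed

lemma ker_carrier: "x \<in> K \<Longrightarrow> x \<in> carrier X" and D_ker: "x \<in> K \<Longrightarrow> act D x = \<zero>\<^bsub>X\<^esub>"
  and kerI: "x \<in> carrier X \<Longrightarrow> act D x = \<zero>\<^bsub>X\<^esub> \<Longrightarrow> x \<in> K"
  by (simp_all add: dirac_ker_def)

lemma additive_subgroup_ker: "additive_subgroup K X"
  unfolding additive_subgroup_def
  by (rule X.add.subgroupI)
    (auto simp: dirac_ker_def act_add act_minus simp flip: a_inv_def intro: X.zero_closed)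

lemma act_D_im: "x \<in> carrier X \<Longrightarrow> act D x \<in> dirac_im X D"
  by (auto simp: dirac_im_def)

lemma im_add: "x \<in> dirac_im X D \<Longrightarrow> y \<in> dirac_im X D \<Longrightarrow> x \<oplus>\<^bsub>X\<^esub> y \<in> dirac_im X D"
  unfolding dirac_im_def by (auto simp flip: act_add)

lemma additive_subgroup_N: "additive_subgroup N X"
proof -
  have "\<ominus>\<^bsub>X\<^esub> x \<in> dirac_im X D" if "x \<in> dirac_im X D" for x
    using that by (auto simp: dirac_im_def image_iff simp flip: act_minus)
  moreover have "\<zero>\<^bsub>X\<^esub> \<in> dirac_im X D"
    unfolding dirac_im_def by (rule image_eqI[of _ _ "\<zero>\<^bsub>X\<^esub>"]) simp_all
  ultimately show ?thesis
    using additive_subgroup.a_subgroup[OF additive_subgroup_ker] im_add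
    unfolding additive_subgroup_def
    by (intro X.add.subgroupI)
      (auto simp: ker_carrier subgroup.m_closed[of K "add_monoid X", simplified]
        additive_subgroup.a_inv_closed[OF additive_subgroup_ker, unfolded a_inv_def] a_inv_def
        dest: subgroup.one_closed)
qed

sublocale ker: additive_subgroup K X by (rule additive_subgroup_ker)
sublocale N: abelian_subgroup N X
  by (rule abelian_subgroupI3[OF additive_subgroup_N X.abelian_group_axioms])

lemma act_ker:
  assumes s: "s \<in> S" and x: "x \<in> K"
  shows "act s x \<in> K"
proof -
  have "act D (act s x) = act (p s) (act D x)"
    using ker_carrier[OF x] twisted(1)[OF s] act_mult by metis
  also have "\<dots> = \<zero>\<^bsub>X\<^esub>" using D_ker[OF x] by simp
  finally show ?thesis using ker_carrier[OF x] by (intro kerI) simp_all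
qed

lemma act_im:
  assumes s: "s \<in> S" and "x \<in> dirac_im X D"
  shows "act s x \<in> dirac_im X D"
proof -
  obtain y where y: "y \<in> carrier X" "x = act D y"
    using assms(2) by (auto simp: dirac_im_def)
  then have "act s x = act D (act (p s) y)"
    using twisted(2)[OF s] act_mult by metis
  then show ?thesis using y unfolding dirac_im_def by auto
qed

lemma cls_eq_iff:
  assumes "x \<in> carrier X" "y \<in> carrier X"
  shows "cls x = cls y \<longleftrightarrow> x \<ominus>\<^bsub>X\<^esub> y \<in> N"
proof -
  have "cls x = cls y \<longleftrightarrow> x \<in> cls y"
    unfolding dirac_class_def
    using assms N.a_repr_independence'[of x y] N.a_rcos_self[of x] by auto
  then show ?thesis
    unfolding dirac_class_def using assms N.a_rcos_module[of y x] by (simp add: X.minus_eq)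
qed

lemma cls_add: "x \<in> carrier X \<Longrightarrow> y \<in> carrier X \<Longrightarrow> cls x \<oplus>\<^bsub>H\<^esub> cls y = cls (x \<oplus>\<^bsub>X\<^esub> y)"
  by (simp add: dirac_cohomology_def dirac_class_def N.a_rcos_sum)

lemma cls_zero: "cls \<zero>\<^bsub>X\<^esub> = \<zero>\<^bsub>H\<^esub>"
  using X.a_coset_add_zero[OF N.a_subset] by (simp add: dirac_cohomology_def dirac_class_def)

lemma carrier_H: "carrier H = cls ` K"
  by (simp add: dirac_cohomology_def)

text \<open>The action is defined as a union over all representatives of a coset; it collapses to
  one class because \<open>N\<close> is stable under Seg(W).\<close>

lemma cls_act:
  assumes s: "s \<in> S" and x: "x \<in> K"
  shows "s \<odot>\<^bsub>H\<^esub> cls x = cls (act s x)"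
proof -
  have "cls (act s y) = cls (act s x)" if "y \<in> cls x" for y
  proof -
    have "\<exists>z\<in>N. y = z \<oplus>\<^bsub>X\<^esub> x"
      using that unfolding dirac_class_def a_r_coset_def' UN_iff singleton_iff .
    then obtain z where z: "z \<in> N" "y = z \<oplus>\<^bsub>X\<^esub> x" ..
    have zx: "z \<in> carrier X" "x \<in> carrier X"
      by (rule ker_carrier, rule IntD1[OF z(1)]) (rule ker_carrier[OF x])
    have "act s z \<in> N"
      using IntI[OF act_ker[OF s IntD1[OF z(1)]] act_im[OF s IntD2[OF z(1)]]] .
    moreover have "act s y \<ominus>\<^bsub>X\<^esub> act s x = act s z"
      using zx by (simp add: z act_add X.minus_eq X.a_assoc X.r_neg)
    ultimately show ?thesis using zx z(2) by (simp add: cls_eq_iff)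
  qed
  moreover have "x \<in> cls x"
    unfolding dirac_class_def by (rule N.a_rcos_self[OF ker_carrier[OF x]])
  ultimately have "(\<Union>y\<in>cls x. cls (act s y)) = cls (act s x)" by blast
  then show ?thesis by (simp add: dirac_cohomology_def)
qed

lemma left_module_H: "left_module S H"
  unfolding left_module_def
proof (intro conjI ballI)
  show "abelian_group H"
  proof (rule abelian_groupI; (unfold carrier_H)?)
    show "\<zero>\<^bsub>H\<^esub> \<in> cls ` K" using ker.zero_closed by (simp flip: cls_zero)
  next
    fix x assume "x \<in> cls ` K"
    then obtain y where y: "y \<in> K" "x = cls y" by blast
    have "cls (\<ominus>\<^bsub>X\<^esub> y) \<oplus>\<^bsub>H\<^esub> x = \<zero>\<^bsub>H\<^esub>"
      using y by (simp add: cls_add ker_carrier X.l_neg cls_zero)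
    then show "\<exists>z\<in>cls ` K. z \<oplus>\<^bsub>H\<^esub> x = \<zero>\<^bsub>H\<^esub>"
      using y by blast
  qed (auto simp: cls_add ker_carrier X.a_ac simp flip: cls_zero)
qed (auto simp: carrier_H cls_act cls_add act_ker S_ring ker_carrier act_add_left act_add act_mult)

end

section \<open>Comparison of the central characters\<close>

context hecke_clifford
begin

lemma dirac_module_S:
  assumes "left_module UNIV X"
  shows "dirac_module X D S parity"
  using assms by unfold_locales (auto simp: D_mult_S)

text \<open>Let \<open>x\<close> in the kernel of \<open>D\<close> represent
  \<open>\<phi> u\<close>. Modulo the image of \<open>D\<close>, \<open>zeta G S D z\<close> acts on
  \<open>x\<close> by its scalar on \<open>U\<close>, and \<open>z\<close> acts in the same way. If
  the two scalars differed, \<open>x\<close> would lie in the image and its class would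
  vanish.\<close>

lemma central_character_eq:
  assumes central: "dirac_square_central G S D"
    and X: "left_module UNIV X" "central_character scl (even_center G UNIV) X \<chi>"
    and U: "left_module S U" "central_character scl (even_center G S) U \<chi>'"
    and \<phi>: "\<phi> \<in> module_homs S U (dirac_cohomology X D)" "u \<in> carrier U"
      "\<phi> u \<noteq> \<zero>\<^bsub>dirac_cohomology X D\<^esub>"
    and z: "z \<in> even_center G UNIV"
  shows "\<chi> z = \<chi>' (zeta G S D z)"
proof (rule ccontr)
  interpret M: dirac_module X D S parity by (rule dirac_module_S[OF X(1)])
  assume neq: "\<chi> z \<noteq> \<chi>' (zeta G S D z)"
  define s where "s = zeta G S D z"
  define t where "t = \<chi>' s"
  obtain y where s: "s \<in> even_center G S" and y: "z - s = d y"
    using zeta[OF central z] unfolding s_def by blast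
  then have sS: "s \<in> S" by (simp add: even_center_def)
  have scalar_S: "scl r 1 \<in> S" for r by simp
  have "\<phi> u \<in> carrier M.H" using \<phi>(1,2) by (auto simp: module_homs_def)
  then obtain x where x: "x \<in> M.K" "\<phi> u = M.cls x" unfolding M.carrier_H by blast
  note xX = M.ker_carrier[OF x(1)]
  \<comment> \<open>The difference of the two characters as an element of the algebra, invertible by
    \<open>neq\<close>.\<close>
  define q where "q = scl (\<chi> z - t) 1"
  have "\<phi> (s \<odot>\<^bsub>U\<^esub> u) = \<phi> (scl t 1 \<odot>\<^bsub>U\<^esub> u)"
    using U(2) s \<phi>(2) by (simp add: central_character_def t_def)
  then have "s \<odot>\<^bsub>M.H\<^esub> \<phi> u = scl t 1 \<odot>\<^bsub>M.H\<^esub> \<phi> u"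
    using \<phi>(1,2) sS scalar_S by (simp add: module_homs_def)
  then have "M.cls (M.act s x) = M.cls (M.act (scl t 1) x)"
    using sS scalar_S x by (simp add: M.cls_act)
  then have im: "M.act s x \<ominus>\<^bsub>X\<^esub> M.act (scl t 1) x \<in> dirac_im X D"
    using xX by (simp add: M.cls_eq_iff)
  \<comment> \<open>The last summand vanishes since \<open>D\<close> kills \<open>x\<close>; hence
    \<open>z - s\<close> sends \<open>x\<close> into the image of \<open>D\<close>.\<close>
  have "M.act (D * y) x = M.act (z - s) x \<oplus>\<^bsub>X\<^esub> M.act (parity y * D) x"
    using xX by (simp add: y dirac_d_eq flip: M.act_add_left)
  then have "M.act (z - s) x = M.act D (M.act y x)"
    using xX by (simp add: M.act_mult M.D_ker[OF x(1)])
  moreover have "M.act z x = M.act (z - s) x \<oplus>\<^bsub>X\<^esub> M.act s x"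
    using xX by (simp flip: M.act_add_left)
  moreover have "M.act z x = M.act q x \<oplus>\<^bsub>X\<^esub> M.act (scl t 1) x"
    using X(2) z xX by (simp add: central_character_def q_def flip: M.act_add_left scale_left_distrib)
  ultimately have "M.act D (M.act y x) \<oplus>\<^bsub>X\<^esub> M.act s x = M.act q x \<oplus>\<^bsub>X\<^esub> M.act (scl t 1) x"
    by simp
  then have "M.act D (M.act y x) \<oplus>\<^bsub>X\<^esub> M.act s x \<oplus>\<^bsub>X\<^esub> \<ominus>\<^bsub>X\<^esub> M.act (scl t 1) x = M.act q x"
    using xX by (subst M.X.add.inv_solve_right'[folded a_inv_def]) simp_all
  then have "M.act q x = M.act D (M.act y x) \<oplus>\<^bsub>X\<^esub> (M.act s x \<ominus>\<^bsub>X\<^esub> M.act (scl t 1) x)"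
    using xX by (simp add: M.X.minus_eq M.X.a_assoc)
  then have "M.act q x \<in> dirac_im X D"
    using M.im_add[OF M.act_D_im im] xX by simp
  then have "M.act (scl (1 / (\<chi> z - t)) 1) (M.act q x) \<in> dirac_im X D"
    by (rule M.act_im[OF scalar_S])
  moreover have "M.act (scl (1 / (\<chi> z - t)) 1) (M.act q x) = x"
    using neq xX by (simp add: q_def t_def s_def scale_mult_left flip: M.act_mult)
  ultimately have "x \<in> M.N" using x(1) by simp
  then have "M.cls x = M.cls \<zero>\<^bsub>X\<^esub>"
    using xX by (simp add: M.cls_eq_iff M.X.minus_eq M.X.add.inv_one[folded a_inv_def])
  then show False using \<phi>(3) x(2) by (simp add: M.cls_zero)
qed

end

theorem theorem3p5:
  fixes scl :: "complex \<Rightarrow> 'h::ring_1 \<Rightarrow> 'h"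
    and G :: "nat \<Rightarrow> 'h set"
    and W :: "('e::euclidean_space \<Rightarrow> 'e) set"
    and \<rho> :: "('e \<Rightarrow> 'e) \<Rightarrow> 'v::real_inner \<Rightarrow> 'v"
    and n :: nat
    and v :: "nat \<Rightarrow> 'v"
    and f :: "('e \<Rightarrow> 'e) \<Rightarrow> 'h"
    and c a :: "nat \<Rightarrow> 'h"
    and D :: 'h and S :: "'h set"
    and X :: "('h, 'x) module" and P :: "nat \<Rightarrow> 'x set"
    and \<chi>\<^sub>\<pi> :: "'h \<Rightarrow> complex"
  assumes "hecke_clifford scl G W \<rho> n v f c a"
    and "S = Seg scl W n f c"
    and "D = dirac n a c"
    and "dirac_square_central G S D"
    and "irreducible_supermodule G X P"
    and "central_character scl (even_center G UNIV) X \<chi>\<^sub>\<pi>"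
  shows "left_module S (dirac_cohomology X D) \<and>
    (\<forall>s\<in>S. \<forall>x\<in>dirac_ker X D. s \<odot>\<^bsub>X\<^esub> x \<in> dirac_ker X D \<and>
      s \<odot>\<^bsub>dirac_cohomology X D\<^esub> dirac_class X D x = dirac_class X D (s \<odot>\<^bsub>X\<^esub> x)) \<and>
    (\<forall>(U :: ('h, 'u) module) \<chi>\<^sub>\<sigma>.
      irreducible_module S U \<longrightarrow>
      central_character scl (even_center G S) U \<chi>\<^sub>\<sigma> \<longrightarrow>
      (\<exists>\<phi>\<in>module_homs S U (dirac_cohomology X D).
         \<exists>u\<in>carrier U. \<phi> u \<noteq> \<zero>\<^bsub>dirac_cohomology X D\<^esub>) \<longrightarrow>
      (\<forall>z\<in>even_center G UNIV. \<chi>\<^sub>\<pi> z = \<chi>\<^sub>\<sigma> (zeta G S D z)))"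
proof -
  interpret hecke_clifford scl G W \<rho> n v f c a by (rule assms(1))
  have X: "left_module UNIV X"
    using assms(5) unfolding irreducible_supermodule_def supermodule_def by blast
  interpret M: dirac_module X D "Seg scl W n f c" parity
    unfolding assms(3) by (rule dirac_module_S[OF X])
  have "left_module S M.H"
    unfolding assms(2) by (rule M.left_module_H)
  moreover have "\<forall>s\<in>S. \<forall>x\<in>M.K. M.act s x \<in> M.K \<and> s \<odot>\<^bsub>M.H\<^esub> M.cls x = M.cls (M.act s x)"
    unfolding assms(2) using M.act_ker M.cls_act by blast
  moreover have "\<chi>\<^sub>\<pi> z = \<chi>\<^sub>\<sigma> (zeta G S D z)"
    if "irreducible_module S U" "central_character scl (even_center G S) U \<chi>\<^sub>\<sigma>"
      "\<phi> \<in> module_homs S U M.H" "u \<in> carrier U" "\<phi> u \<noteq> \<zero>\<^bsub>M.H\<^esub>" "z \<in> even_center G UNIV"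
    for U :: "('h, 'u) module" and \<chi>\<^sub>\<sigma> \<phi> u z
    unfolding assms(2,3)
    by (rule central_character_eq[where U = U and \<phi> = \<phi> and u = u])
      (use that assms(4,6) X in \<open>simp_all add: assms(2,3) irreducible_module_def\<close>)
  ultimately show ?thesis by blast
qed

end
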